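(* Let $\xi,\eta\in E_1$, where $E_1\subset\{0,1\}^\omega$ is the set of infinite binary words whose Schreier graph for the Basilica group has one end. (1) If $\xi=u1^\omega$ and $\eta=w1^\omega$ with $u,w\in\{0,1\}^*$, then $\Gamma_\xi=\Gamma_\eta$. If $\xi=u1^\omega$ for some $u\in\{0,1\}^*$ but $\eta\ne w1^\omega$ for every $w\in\{0,1\}^*$, then $\Gamma_\xi\not\simeq\Gamma_\eta$. (2) Suppose that $\xi\neq u1^\omega$ and $\eta\ne w1^\omega$ for all $u,w\in\{0,1\}^*$. Let $(k,\{m_l\}_{l\ge0},\{t_l\}_{l\ge0})$ and $(k',\{m'_l\}_{l\ge0},\{t'_l\}_{l\ge0})$ be the triples giving the canonical representations $$\xi=0^{k-1}1(0x^0_1\ldots0x^0_{m_0/2})1^{t_1}(0x^1_1\ldots0x^1_{m_1/2})1^{t_2}\ldots,\qquad \eta=0^{k'-1}1(0y^0_1\ldots0y^0_{m'_0/2})1^{t'_1}(0y^1_1\ldots0y^1_{m'_1/2})1^{t'_2}\ldots,$$ with $x^j_i,y^j_i\in\{0,1\}$, and write $M_i=\sum_{l=0}^im_l$, $T_j=\sum_{l=0}^jt_l$, $M'_i=\sum_{l=0}^im'_l$, $T'_j=\sum_{l=0}^jt'_l$. Then $\Gamma_\eta\simeq\Gamma_\xi$ if and only if there exist $r,s\ge1$ such that, for each $n\ge0$: (a) $m_{r+n}=m'_{s+n}$ and $t_{r+n+1}=t'_{s+n+1}$; (b) $k+T_r+M_{r-1}=k'+T'_s+M'_{s-1}$; (c)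 either $y^{s+n}_p=x^{r+n}_p$ for all $p=1,\ldots,m_{r+n}/2$, or $y^{s+n}_p=1-x^{r+n}_p$ for all $p=1,\ldots,m_{r+n}/2$. Here $\simeq$ denotes isomorphism of unrooted, unlabeled graphs.
   Context: The Basilica group $B=\langle a,b\rangle$ acts on finite and infinite binary words by $a(0w)=0\,b(w)$, $a(1w)=1w$, $b(0w)=1\,a(w)$, $b(1w)=0w$. For $\xi\in\{0,1\}^\omega$, the Schreier graph $\Gamma_\xi$ is the undirected (unlabeled) multigraph with vertex set $B\cdot\xi$ and, for every vertex $x$ and $s\in\{a,b\}$, one edge joining $x$ and $s(x)$ (a loop if $s(x)=x$; parallel edges allowed). Explicitly, $E_1=\{\alpha_1\beta_1\alpha_2\beta_2\ldots : \alpha_i,\beta_j\in\{0,1\},\ \{\alpha_i\}$ and $\{\beta_j\}$ both contain infinitely many $1$'s$\}$. Canonical representation: every $\xi\in E_1$ that is not of the form $w1^\omega$ ($w\in\{0,1\}^*$) can be written as $\xi=0^{k-1}1(0x^0_1\ldots0x^0_{m_0/2})1^{t_1}(0x^1_1\ldots0x^1_{m_1/2})1^{t_2}\ldots$ with $x_i^j\in\{0,1\}$, for a unique triple $(k,\{m_l\}_{l\ge0},\{t_l\}_{l\ge0})$ such that $k\ge1$ is an integer, $m_0\ge0$ is an even integer, $t_0=0$, and for $l\ge1$ the $m_l$ are strictly positive even integers and the $t_l$ are strictly positive integers. *)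

theory Defs
  imports
    "HOL-Library.Stream"
    "HOL-Library.Z2"
    "HOL-Algebra.Bij"
    "HOL-Algebra.Generated_Groups"
begin

datatype gen = Gen_a | Gen_b

fun other_gen :: "gen \<Rightarrow> gen" where
  "other_gen Gen_a = Gen_b"
| "other_gen Gen_b = Gen_a"

text \<open>
  The mutually recursive actions of the two generators as one corecursive function; the recursion
  in its usual form is \<open>act_Stream\<close> below.
\<close>

primcorec act :: "gen \<Rightarrow> bit stream \<Rightarrow> bit stream" where
  "shd (act s w) = (if s = Gen_a then shd w else 1 - shd w)"
| "stl (act s w) = (if shd w = 0 then act (other_gen s) (stl w) else stl w)"

lemma act_Stream [simp]:
  "act Gen_a (0 ## w) = 0 ## act Gen_b w"
  "act Gen_a (1 ## w) = 1 ## w"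
  "act Gen_b (0 ## w) = 1 ## act Gen_a w"
  "act Gen_b (1 ## w) = 0 ## w"
  by (simp_all add: stream.expand)

primcorec act_inv :: "gen \<Rightarrow> bit stream \<Rightarrow> bit stream" where
  "shd (act_inv s w) = (if s = Gen_a then shd w else 1 - shd w)"
| "stl (act_inv s w) =
     (if (s = Gen_a) = (shd w = 0) then act_inv (other_gen s) (stl w) else stl w)"

lemma act_inv_act [simp]: "act_inv s (act s w) = w"
proof -
  have "act_inv s (act s w) !! n = w !! n" for n
    by (induction n arbitrary: s w; case_tac s; auto)
  then show ?thesis by (metis ext stream_smap_nats)
qed

lemma act_act_inv [simp]: "act s (act_inv s w) = w"
proof -
  have "act s (act_inv s w) !! n = w !! n" for n
    by (induction n arbitrary: s w; case_tac s; auto)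
  then show ?thesis by (metis ext stream_smap_nats)
qed

lemma bij_act: "bij (act s)"
  by (rule bijI') (metis act_inv_act, metis act_act_inv)

definition basilica :: "(bit stream \<Rightarrow> bit stream) set" where
  "basilica = generate (BijGroup UNIV) {act Gen_a, act Gen_b}"

definition basilica_orbit :: "bit stream \<Rightarrow> bit stream set" where
  "basilica_orbit \<xi> = {g \<xi> | g. g \<in> basilica}"

text \<open>
  Undirected multigraphs with edges as objects: \<open>ends e\<close> is the set of the endpoints of \<open>e\<close>,
  a singleton if \<open>e\<close> is a loop.
\<close>

record ('v, 'e) multigraph =
  vertices :: "'v set"
  edges :: "'e set"
  ends :: "'e \<Rightarrow> 'v set"

definition multigraph_iso ::
    "('v, 'e) multigraph \<Rightarrow> ('w, 'f) multigraph \<Rightarrow> bool" (infix "\<simeq>" 50) where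
  "G \<simeq> H \<longleftrightarrow> (\<exists>f g. bij_betw f (vertices G) (vertices H) \<and> bij_betw g (edges G) (edges H) \<and>
     (\<forall>e\<in>edges G. ends H (g e) = f ` ends G e))"

text \<open>The edge \<open>(x, s)\<close> is the one joining \<open>x\<close> and \<open>s(x)\<close>.\<close>

definition schreier :: "bit stream \<Rightarrow> (bit stream, bit stream \<times> gen) multigraph" where
  "schreier \<xi> =
     \<lparr>vertices = basilica_orbit \<xi>,
      edges = basilica_orbit \<xi> \<times> UNIV,
      ends = (\<lambda>(x, s). {x, act s x})\<rparr>"

text \<open>
  Words \<open>\<alpha>\<^sub>1\<beta>\<^sub>1\<alpha>\<^sub>2\<beta>\<^sub>2\<dots>\<close> in which both \<open>\<alpha>\<close> and \<open>\<beta>\<close> contain infinitely many ones; these are exactly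
  the words whose Schreier graph has one end. Positions in a stream are counted from 0.
\<close>

definition E1 :: "bit stream set" where
  "E1 = {\<xi>. infinite {i. \<xi> !! (2 * i) = 1} \<and> infinite {i. \<xi> !! (2 * i + 1) = 1}}"

text \<open>
  In the canonical representation, \<open>x j i\<close> is the letter with upper index \<open>j\<close> and lower index \<open>i\<close>,
  where \<open>1 \<le> i \<le> m j div 2\<close>; the other values of \<open>x\<close> are irrelevant. The \<open>j\<close>-th list that is
  flattened below is \<open>0x\<^sup>j\<^sub>1\<dots>0x\<^sup>j\<^sub>q\<close> with \<open>q = m j div 2\<close> followed by \<open>t (j + 1)\<close> ones; it is nonempty since
  \<open>t (j + 1) > 0\<close>.
\<close>

definition canonical_rep ::
    "bit stream \<Rightarrow> nat \<Rightarrow> (nat \<Rightarrow> nat) \<Rightarrow> (nat \<Rightarrow> nat) \<Rightarrow> (nat \<Rightarrow> nat \<Rightarrow> bit) \<Rightarrow> bool" where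
  "canonical_rep \<xi> k m t x \<longleftrightarrow>
     k \<ge> 1 \<and> even (m 0) \<and> t 0 = 0 \<and> (\<forall>l\<ge>1. m l > 0 \<and> even (m l) \<and> t l > 0) \<and>
     \<xi> = (replicate (k - 1) 0 @ [1]) @-
         flat (smap (\<lambda>j. concat (map (\<lambda>i. [0, x j i]) [1..<m j div 2 + 1])
                          @ replicate (t (j + 1)) 1) nats)"

end

theory Submission
  imports Defs
begin

text \<open>
The cycles of the two generators make a Schreier graph a cactus: every vertex lies on one cycle of
\<open>a\<close> and one of \<open>b\<close>, and two different cycles share at most one vertex. For a word in \<open>E1\<close> all cycles
are finite, and there is one end. Write a word as \<open>u = 0\<^sup>n1z\<close> and call \<open>n\<close> its lead. For one
of the generators the recursion stops at this first \<open>1\<close>; on its cycle \<open>u\<close> is the vertex nearest to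
the end, and the length of this cycle is \<open>2\<^sup>k\<close> with \<open>k\<close> half of \<open>n\<close>, rounded up. On the other cycle through \<open>u\<close> the vertex nearest to the end is another one, the parent
of \<open>u\<close>, obtained by replacing ones of \<open>u\<close> by zeros; its lead is larger. So the vertices form a tree
directed to the end, in which the children of \<open>v\<close> are the other vertices of the cycle hanging
from \<open>v\<close>. They are indexed by their distance \<open>d\<close> from \<open>v\<close> along that cycle, the offset, and the
lead of a child depends only on \<open>d\<close> and on the lead of \<open>v\<close>. Hence what hangs from a vertex is
determined by its lead.

Consequently the whole graph is determined by the leads and offsets along one ray \<open>u\<close>, parent
of \<open>u\<close>, parent of that, and so on. Each finite part is symmetric under reflecting the cycle at its
top, so an offset matters only up to replacing \<open>d\<close> by \<open>N - d\<close>, where \<open>N\<close> is the length of the cycle. Two rays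
are matching if they agree in this sense, and \<open>schreier_iso_iff_matching\<close> says that two graphs are
isomorphic if and only if tails of their rays match. For one direction, a vertex \<open>v\<close> is a proper
ancestor of \<open>u\<close> precisely if deleting \<open>v\<close> leaves \<open>u\<close> in a finite component (\<open>cuts_iff\<close>), so an
isomorphism of graphs commutes with parents; it preserves leads, as the lead of \<open>v\<close> is the height of
the tree below \<open>v\<close> (\<open>lead_ge_iff\<close>), and offsets up to reflection, as it maps cycles to cycles. For the
other direction, a match of rays is extended downwards along the tree, reflecting the cycles on the
ray where the offsets disagree.

It remains to read rays off words. If \<open>u = 0\<^sup>n1(0x\<^sub>1\<dots>0x\<^sub>p)1z\<close> then the parent of \<open>u\<close> is
\<open>0\<^sup>n\<^sup>'1z\<close> with \<open>n' = n + 2p + 1\<close>, and the offset of \<open>u\<close> has the binary digits \<open>0\<dots>01x\<^sub>1\<dots>x\<^sub>p\<close>, lowest first. Reflection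
of the cycle complements the letters \<open>x\<^sub>i\<close>. So a ray amounts to a lead and a sequence of blocks \<open>x\<^sub>1\<dots>x\<^sub>p\<close>, each up
to complement (\<open>matching_iff_blocks\<close>). In a canonical representation the blocks of the word are the
\<open>x\<^sup>j\<close>, with \<open>t (j + 1) - 1\<close> empty blocks after the \<open>j\<close>-th; a word ending in \<open>1\<^sup>\<omega>\<close> has only empty blocks from some
point on. Comparing the sequences gives the three statements.
\<close>

section \<open>Words along a cycle\<close>

text \<open>
The first \<open>1\<close> in a position of the parity of \<open>e\<close> stops the recursion of the generator \<open>gen_of e\<close>: the
generator \<open>a\<close> recurses through zeros in even positions and \<open>b\<close> through zeros in odd ones.
\<close>

definition gen_of :: "nat \<Rightarrow> gen" where
  "gen_of e = (if even e then Gen_a else Gen_b)"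

definition cycle_size :: "nat \<Rightarrow> nat" where
  "cycle_size e = 2 ^ ((e + 1) div 2)"

text \<open>
The vertices of a cycle of the generator \<open>gen_of e\<close>. If the recursion of this generator stops at the
letter \<open>1\<close> in position \<open>e\<close>, the earlier positions of the parity of \<open>e\<close> contain \<open>0\<close>, and the generator acts
on the remaining earlier letters as on the binary digits of a number \<open>d\<close>, lowest digit first, by
subtracting one. There are \<open>(e + 1) div 2\<close> such letters.
\<close>

fun cycle_word :: "nat \<Rightarrow> nat \<Rightarrow> bit stream \<Rightarrow> bit stream" where
  "cycle_word 0 d z = 1 ## z"
| "cycle_word (Suc e) d z =
     (if even e then of_bool (odd d) ## cycle_word e (d div 2) z else 0 ## cycle_word e d z)"

definition pred_mod :: "nat \<Rightarrow> nat \<Rightarrow> nat" where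
  "pred_mod N d = (if d = 0 then N - 1 else d - 1)"

lemma cycle_size_0 [simp]: "cycle_size 0 = 1"
  by (simp add: cycle_size_def)

lemma cycle_size_Suc: "cycle_size (Suc e) = (if even e then 2 * cycle_size e else cycle_size e)"
  by (auto simp: cycle_size_def elim!: evenE oddE)

lemma cycle_size_pos [simp]: "0 < cycle_size e"
  by (simp add: cycle_size_def)

text \<open>
Each level of recursion of \<open>b\<close> handles one binary digit: it flips the digit and borrows, that is,
recurses, precisely if the digit was \<open>0\<close>. The generator \<open>a\<close> keeps a \<open>0\<close> and
hands over to \<open>b\<close>.
\<close>

lemma act_cycle_word: "d < cycle_size e \<Longrightarrow> act (gen_of e) (cycle_word e d z) = cycle_word e (pred_mod (cycle_size e) d) z"
proof (induction e arbitrary: d)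
  case 0
  then show ?case by (simp add: gen_of_def)
next
  case (Suc e)
  show ?case
  proof (cases "even e")
    case True
    then have N: "cycle_size (Suc e) = 2 * cycle_size e" and d2: "d div 2 < cycle_size e"
      using Suc.prems by (auto simp: cycle_size_Suc)
    have IH: "act Gen_a (cycle_word e (d div 2) z) = cycle_word e (pred_mod (cycle_size e) (d div 2)) z"
      using Suc.IH[OF d2] True by (simp add: gen_of_def)
    show ?thesis
    proof (cases "odd d")
      case d: True
      then have "pred_mod (cycle_size (Suc e)) d = d - 1" "even (d - 1)" "(d - 1) div 2 = d div 2"
        by (auto simp: pred_mod_def elim!: oddE)
      with d True show ?thesis by (simp add: gen_of_def)
    next
      case d: False
      have "odd (pred_mod (cycle_size (Suc e)) d)"
        "pred_mod (cycle_size (Suc e)) d div 2 = pred_mod (cycle_size e) (d div 2)"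
        using d cycle_size_pos[of e] unfolding pred_mod_def N by (auto elim!: evenE)
      with d True IH show ?thesis by (simp add: gen_of_def)
    qed
  next
    case False
    with Suc show ?thesis by (simp add: gen_of_def cycle_size_Suc)
  qed
qed

text \<open>
A word lies on only one cycle of each generator, and at only one place of it. The parity condition
fixes the generator.
\<close>

lemma cycle_word_inj:
  "\<lbrakk>cycle_word e d z = cycle_word e' d' z'; d < cycle_size e; d' < cycle_size e'; even e = even e'\<rbrakk> \<Longrightarrow> e = e' \<and> d = d' \<and> z = z'"
proof (induction e arbitrary: e' d d')
  case 0
  then show ?case by (cases e') (auto split: if_splits)
next
  case (Suc e)
  then obtain e'' where e': "e' = Suc e''"
    by (cases e') (auto split: if_splits)
  have par: "even e = even e''"
    using Suc.prems e' by simp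
  show ?case
  proof (cases "even e")
    case True
    have "odd d = odd d'" "cycle_word e (d div 2) z = cycle_word e'' (d' div 2) z'"
      using Suc.prems(1) e' par True by (auto split: if_splits)
    moreover have "d div 2 < cycle_size e" "d' div 2 < cycle_size e''"
      using Suc.prems e' par True by (auto simp: cycle_size_Suc)
    ultimately have "e = e'' \<and> d div 2 = d' div 2 \<and> z = z'"
      using Suc.IH par by blast
    with \<open>odd d = odd d'\<close> have "d = d'"
      by (metis div_mult_mod_eq odd_iff_mod_2_eq_one parity_cases)
    with \<open>e = e'' \<and> d div 2 = d' div 2 \<and> z = z'\<close> show ?thesis using e' by simp
  next
    case False
    then show ?thesis using Suc.prems Suc.IH[of d e'' d'] par by (auto simp: e' cycle_size_Suc)
  qed
qed

lemma cycle_word_root: "cycle_word e 0 z = replicate e 0 @- 1 ## z"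
  by (induction e) auto

definition lead :: "bit stream \<Rightarrow> nat" where
  "lead u = (LEAST i. u !! i = 1)"

lemma lead_replicate [simp]: "lead (replicate n 0 @- 1 ## z) = n"
  unfolding lead_def
proof (rule Least_equality)
  fix i assume "(replicate n 0 @- 1 ## z) !! i = (1::bit)"
  then show "n \<le> i" by (cases "i < n") (auto simp: shift_snth_less)
qed simp

lemma lead_1 [simp]: "lead (1 ## z) = 0"
  by (simp add: lead_def)

lemma E1_Cons [simp]: "c ## w \<in> E1 \<longleftrightarrow> w \<in> E1"
proof -
  have "infinite {i. P i} \<longleftrightarrow> infinite {i. P (Suc i)}" for P :: "nat \<Rightarrow> bool"
  proof -
    have "{i. P (Suc i)} = Suc -` {i. P i}" by auto
    moreover have "{i. P i} \<subseteq> insert 0 (Suc ` {i. P (Suc i)})"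
      by (auto simp: image_iff) (metis not0_implies_Suc)
    ultimately show ?thesis
      by (metis finite_imageI finite_insert finite_subset finite_vimageI inj_Suc)
  qed
  from this[of "\<lambda>i. (c ## w) !! (2 * i) = 1"] show ?thesis by (auto simp: E1_def)
qed

lemma E1_shift [simp]: "u @- w \<in> E1 \<longleftrightarrow> w \<in> E1"
  by (induction u) auto

lemma E1_cycle_word [simp]: "cycle_word e d z \<in> E1 \<longleftrightarrow> z \<in> E1"
  by (induction e arbitrary: d) auto

text \<open>
The groups \<open>0x\<^sub>1\<dots>0x\<^sub>p\<close> that occur between two ones in canonical representations.
\<close>

definition dilute :: "bit list \<Rightarrow> bit list" where
  "dilute xs = concat (map (\<lambda>x. [0, x]) xs)"

lemma dilute_simps [simp]: "dilute [] = []" "dilute (x # xs) = 0 # x # dilute xs"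
  by (simp_all add: dilute_def)

lemma length_dilute [simp]: "length (dilute xs) = 2 * length xs"
  by (induction xs) auto

fun binval :: "bit list \<Rightarrow> nat" where
  "binval [] = 0"
| "binval (x # xs) = of_bool (x = 1) + 2 * binval xs"

lemma binval_less: "binval xs < 2 ^ length xs"
  by (induction xs) (auto simp: of_bool_def)

lemma binval_inj: "\<lbrakk>length xs = length ys; binval xs = binval ys\<rbrakk> \<Longrightarrow> xs = ys"
proof (induction xs ys rule: list_induct2)
  case (Cons x xs y ys)
  then have "of_bool (x = 1) + 2 * binval xs = of_bool (y = 1) + 2 * binval ys" by simp
  then have "(x = 1) = (y = 1)" "binval xs = binval ys"
    by (auto simp: of_bool_def split: if_splits) presburger+
  then show ?case using Cons.IH by auto
qed simp

text \<open>
A number and its digitwise complement add up to \<open>1\<dots>1\<close>.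
\<close>

lemma binval_compl: "binval (map (\<lambda>x. 1 - x) xs) + binval xs + 1 = 2 ^ length xs"
  by (induction xs) (auto simp: of_bool_def)

lemma E1_obtain_lead:
  assumes "u \<in> E1"
  obtains n w where "u = replicate n 0 @- 1 ## w"
proof -
  have "\<exists>i. u !! i = 1"
    using assms by (auto simp: E1_def dest!: infinite_imp_nonempty)
  then obtain i where "u !! i = 1" by blast
  then have "\<exists>n w. u = replicate n 0 @- 1 ## w"
  proof (induction i arbitrary: u)
    case 0
    then show ?case by (intro exI[of _ 0] exI[of _ "stl u"]) (rule stream.expand, simp)
  next
    case (Suc i)
    then obtain n w where "stl u = replicate n 0 @- 1 ## w" by force
    then have "shd u = 1 \<Longrightarrow> u = replicate 0 0 @- 1 ## stl u"
      and "shd u = 0 \<Longrightarrow> u = replicate (Suc n) 0 @- 1 ## w"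
      by (metis replicate_0 replicate_Suc shift_simps(1) shift.simps stream.collapse)+
    then show ?case by (cases "shd u") blast+
  qed
  with that show thesis by blast
qed

text \<open>
The letters in even positions are cut off at their first \<open>1\<close>, whatever the letters in between are.
\<close>

lemma E1_obtain_dilute:
  assumes "w \<in> E1"
  obtains xs z where "w = dilute xs @- 1 ## z"
proof -
  have "\<exists>i. w !! (2 * i) = 1"
    using assms by (auto simp: E1_def dest!: infinite_imp_nonempty)
  then obtain i where "w !! (2 * i) = 1" by blast
  then have "\<exists>xs z. w = dilute xs @- 1 ## z"
  proof (induction i arbitrary: w)
    case 0
    then show ?case by (intro exI[of _ "[]"] exI[of _ "stl w"]) (rule stream.expand, simp)
  next
    case (Suc i)
    show ?case
    proof (cases "shd w = 1")
      case True
      then show ?thesis by (intro exI[of _ "[]"] exI[of _ "stl w"]) (rule stream.expand, simp)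
    next
      case False
      obtain xs z where "stl (stl w) = dilute xs @- 1 ## z"
        using Suc by force
      moreover have "w = 0 ## shd (stl w) ## stl (stl w)"
        using False by (metis bit_not_one_iff stream.collapse)
      ultimately have "w = dilute (shd (stl w) # xs) @- 1 ## z" by simp
      then show ?thesis by blast
    qed
  qed
  with that show thesis by blast
qed

lemma cycle_word_dilute_even: "cycle_word (2 * length xs) (binval xs) z = dilute xs @- 1 ## z"
  by (induction xs) auto

text \<open>
The word \<open>0\<^sup>n1(0x\<^sub>1\<dots>0x\<^sub>p)1z\<close> seen as a point of the cycle whose recursion is stopped by the second
displayed \<open>1\<close>: the digits are those in the positions of the parity of \<open>n\<close>, namely \<open>n div 2\<close> zeros, then the first
displayed \<open>1\<close>, then \<open>x\<^sub>1\<dots>x\<^sub>p\<close>.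
\<close>

lemma cycle_word_dilute:
  "cycle_word (Suc (n + 2 * length xs)) (2 ^ (n div 2) * (1 + 2 * binval xs)) z =
     replicate n 0 @- 1 ## dilute xs @- 1 ## z"
proof (induction n)
  case 0
  show ?case by (simp add: cycle_word_dilute_even)
next
  case (Suc n)
  show ?case
  proof (cases "even n")
    case True
    then have "Suc n div 2 = n div 2" by simp
    with Suc True show ?thesis by simp
  next
    case False
    then have "Suc n div 2 = Suc (n div 2)" by simp
    with Suc False show ?thesis by (simp add: algebra_simps)
  qed
qed

section \<open>The tree of cycles\<close>

lemma lead_Cons:
  assumes "w !! i = 1"
  shows "lead (c ## w) = (if c = 1 then 0 else Suc (lead w))"
proof (cases "c = 1")
  case False
  have "lead (c ## w) = Suc (LEAST i. (c ## w) !! Suc i = 1)"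
    unfolding lead_def by (rule Least_Suc[of _ "Suc i"]) (use assms False in auto)
  with False show ?thesis by (simp add: lead_def)
qed simp

lemma snth_cycle_word: "cycle_word e d z !! e = 1"
  by (induction e arbitrary: d) auto

lemma lead_cycle_word_Suc:
  "lead (cycle_word (Suc e) d z) =
     (if odd e then Suc (lead (cycle_word e d z))
      else if odd d then 0 else Suc (lead (cycle_word e (d div 2) z)))"
  using lead_Cons[OF snth_cycle_word] by simp

lemma lead_cycle_word_0 [simp]: "lead (cycle_word e 0 z) = e"
  by (simp add: cycle_word_root)

text \<open>
For \<open>d \<noteq> 0\<close> the first \<open>1\<close> is the lowest nonzero digit of \<open>d\<close>, so its position depends on \<open>e\<close> and on the
multiplicity of \<open>2\<close> in \<open>d\<close> only. As the size of the cycle is a power of two, this multiplicity is the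
same for \<open>d\<close> and for its negative modulo the size. This is what makes the part of the graph that hangs from a
vertex symmetric under reflection.
\<close>

lemma lead_cycle_word:
  assumes "0 < d" "d < cycle_size e"
  shows "lead (cycle_word e d z) < e" and "even (lead (cycle_word e d z)) \<longleftrightarrow> odd e"
    and "lead (cycle_word e d z) = lead (cycle_word e d z')"
    and "lead (cycle_word e (cycle_size e - d) z) = lead (cycle_word e d z)"
proof -
  have "lead (cycle_word e d z) < e \<and> (even (lead (cycle_word e d z)) \<longleftrightarrow> odd e) \<and>
    lead (cycle_word e d z) = lead (cycle_word e d z') \<and> lead (cycle_word e (cycle_size e - d) z) = lead (cycle_word e d z)"
    using assms
  proof (induction e arbitrary: d)
    case 0
    then show ?case by simp
  next
    case (Suc e)
    show ?case
    proof (cases "even e")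
      case False
      then have "d < cycle_size e" using Suc.prems by (simp add: cycle_size_Suc)
      then have "lead (cycle_word e d z) < e \<and> (even (lead (cycle_word e d z)) \<longleftrightarrow> odd e) \<and>
        lead (cycle_word e d z) = lead (cycle_word e d z') \<and> lead (cycle_word e (cycle_size e - d) z) = lead (cycle_word e d z)"
        using Suc.IH Suc.prems(1) by blast
      with False show ?thesis by (auto simp add: lead_cycle_word_Suc cycle_size_Suc simp del: cycle_word.simps)
    next
      case e: True
      then have N: "cycle_size (Suc e) = 2 * cycle_size e" by (simp add: cycle_size_Suc)
      show ?thesis
      proof (cases "odd d")
        case True
        with e Suc.prems N show ?thesis by (simp add: lead_cycle_word_Suc del: cycle_word.simps)
      next
        case False
        then have d: "0 < d div 2" "d div 2 < cycle_size e"
          "(cycle_size (Suc e) - d) div 2 = cycle_size e - d div 2"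
          using Suc.prems by (auto simp: N elim!: evenE)
        with Suc.IH[OF d(1,2)] e False Suc.prems show ?thesis
          by (auto simp add: lead_cycle_word_Suc N simp del: cycle_word.simps)
      qed
    qed
  qed
  then show "lead (cycle_word e d z) < e" "even (lead (cycle_word e d z)) \<longleftrightarrow> odd e"
    "lead (cycle_word e d z) = lead (cycle_word e d z')" "lead (cycle_word e (cycle_size e - d) z) = lead (cycle_word e d z)"
    by blast+
qed

lemma offset_dilute_less:
  "2 ^ (n div 2) * (1 + 2 * binval xs) < cycle_size (Suc (n + 2 * length xs))"
proof -
  have "2 ^ (n div 2) * (1 + 2 * binval xs) < 2 ^ (n div 2) * (2 * 2 ^ length xs :: nat)"
    using binval_less[of xs] by (intro mult_strict_left_mono) auto
  also have "\<dots> = cycle_size (Suc (n + 2 * length xs))"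
    by (simp add: cycle_size_def power_add)
  finally show ?thesis .
qed

text \<open>
Each word in \<open>E1\<close> is a vertex other than the root, \<open>d = 0\<close>, of one of its two cycles: the one of the
generator whose recursion does not stop at the first \<open>1\<close>.
\<close>

lemma E1_obtain_cycle_word:
  assumes "u \<in> E1"
  obtains e d z where "0 < d" "d < cycle_size e" "u = cycle_word e d z" "z \<in> E1"
proof -
  obtain n w where u: "u = replicate n 0 @- 1 ## w"
    using E1_obtain_lead assms by blast
  with assms have "w \<in> E1" by simp
  then obtain xs z where w: "w = dilute xs @- 1 ## z"
    using E1_obtain_dilute by blast
  show thesis
    using that[OF _ offset_dilute_less[of n xs], of z] cycle_word_dilute[of n xs z] u w \<open>w \<in> E1\<close> by simp
qed

lemma cycle_word_proper_inj:
  assumes "cycle_word e d z = cycle_word e' d' z'" "0 < d" "d < cycle_size e" "0 < d'" "d' < cycle_size e'"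
  shows "e = e' \<and> d = d' \<and> z = z'"
  using assms cycle_word_inj lead_cycle_word(2) by metis

text \<open>
The vertices of the cycle that hangs from \<open>v\<close>, which is itself the vertex number \<open>0\<close>.
\<close>

definition hang :: "bit stream \<Rightarrow> nat \<Rightarrow> bit stream" where
  "hang v d = cycle_word (lead v) d (sdrop (Suc (lead v)) v)"

text \<open>
Each word in \<open>E1\<close> is a root on one of its two cycles and a proper vertex of the other. The parent is the root
of the latter cycle, and the offset is the place on it.
\<close>

definition parent :: "bit stream \<Rightarrow> bit stream" where
  "parent u = (THE v. \<exists>e d z. 0 < d \<and> d < cycle_size e \<and> u = cycle_word e d z \<and> v = cycle_word e 0 z)"

definition offset :: "bit stream \<Rightarrow> nat" where
  "offset u = (THE d. \<exists>e z. 0 < d \<and> d < cycle_size e \<and> u = cycle_word e d z)"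

lemma hang_cycle_word [simp]: "hang (cycle_word e 0 z) d = cycle_word e d z"
proof -
  have "sdrop (Suc e) (replicate e 0 @- 1 ## z) = z"
    by (simp add: sdrop_shift del: sdrop.simps(2)) (simp add: Suc_diff_le)
  then show ?thesis by (simp add: hang_def) (simp add: cycle_word_root)
qed

lemma parent_cycle_word:
  assumes "0 < d" "d < cycle_size e"
  shows "parent (cycle_word e d z) = cycle_word e 0 z" and "offset (cycle_word e d z) = d"
  unfolding parent_def offset_def
  by (rule the_equality; use assms cycle_word_proper_inj in blast)+

lemma E1_eq_cycle_word:
  assumes "v \<in> E1" obtains z where "v = cycle_word (lead v) 0 z" "z \<in> E1"
  using E1_obtain_lead[OF assms] assms by (metis E1_Cons E1_shift cycle_word_root lead_replicate)

lemma hang_E1 [simp]: "v \<in> E1 \<Longrightarrow> hang v d \<in> E1"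
  by (metis E1_cycle_word E1_eq_cycle_word hang_cycle_word)

lemma hang_0 [simp]: "v \<in> E1 \<Longrightarrow> hang v 0 = v"
  by (metis E1_eq_cycle_word hang_cycle_word)

context
  fixes v :: "bit stream" and d :: nat
  assumes v: "v \<in> E1" and d: "0 < d" "d < cycle_size (lead v)"
begin

lemma hang_proper:
  shows parent_hang: "parent (hang v d) = v"
    and offset_hang: "offset (hang v d) = d"
    and lead_hang_less: "lead (hang v d) < lead v"
    and even_lead_hang: "even (lead (hang v d)) \<longleftrightarrow> odd (lead v)"
proof -
  obtain z where z: "v = cycle_word (lead v) 0 z"
    using E1_eq_cycle_word v by blast
  then have h: "hang v d = cycle_word (lead v) d z"
    by (metis hang_cycle_word)
  show "parent (hang v d) = v" "offset (hang v d) = d" "lead (hang v d) < lead v"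
    "even (lead (hang v d)) \<longleftrightarrow> odd (lead v)"
    unfolding h using d parent_cycle_word[OF d] lead_cycle_word[OF d] z by metis+
qed

text \<open>
By iteration the whole subtree below a child, not only its lead, is determined by the lead of the
parent and the offset; by \<open>lead_hang_neg\<close> the offset matters only up to sign.
\<close>

lemma lead_hang_cong: "lead w = lead v \<Longrightarrow> lead (hang w d) = lead (hang v d)"
  unfolding hang_def using d lead_cycle_word(3) by metis

lemma lead_hang_neg: "lead w = lead v \<Longrightarrow> lead (hang w (cycle_size (lead v) - d)) = lead (hang v d)"
  unfolding hang_def using d lead_cycle_word(3,4) by metis

end

lemma hang_parent:
  assumes "u \<in> E1"
  shows "parent u \<in> E1" and "hang (parent u) (offset u) = u"
    and "0 < offset u" and "offset u < cycle_size (lead (parent u))"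
proof -
  obtain e d z where "0 < d" "d < cycle_size e" "u = cycle_word e d z" "z \<in> E1"
    using assms E1_obtain_cycle_word by blast
  then show "parent u \<in> E1" "hang (parent u) (offset u) = u"
    "0 < offset u" "offset u < cycle_size (lead (parent u))"
    by (simp_all add: parent_cycle_word)
qed

lemma lead_parent: "u \<in> E1 \<Longrightarrow> lead u < lead (parent u)"
  using hang_parent[of u] lead_hang_less[of "parent u" "offset u"] by simp

lemma act_hang:
  "d < cycle_size (lead v) \<Longrightarrow> act (gen_of (lead v)) (hang v d) = hang v (pred_mod (cycle_size (lead v)) d)"
  by (simp add: hang_def act_cycle_word)

lemma E1_obtain_cycle:
  assumes "x \<in> E1"
  obtains v d where "v \<in> E1" "d < cycle_size (lead v)" "s = gen_of (lead v)" "x = hang v d"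
proof (cases "s = gen_of (lead x)")
  case True
  then show thesis using that[of x 0] assms by simp
next
  case False
  have "even (lead x) \<longleftrightarrow> odd (lead (parent x))"
    using even_lead_hang[of "parent x" "offset x"] hang_parent[OF assms] by simp
  with False have "s = gen_of (lead (parent x))" by (cases s) (auto simp: gen_of_def split: if_splits)
  then show thesis using that[of "parent x" "offset x"] hang_parent[OF assms] by auto
qed

lemma act_E1 [simp]: "x \<in> E1 \<Longrightarrow> act s x \<in> E1"
  by (metis E1_obtain_cycle act_hang hang_E1)

text \<open>
The child \<open>0\<^sup>n11z\<close> of \<open>0\<^sup>n01z\<close> shows that leads go up by one along some path from a leaf to \<open>v\<close>.
\<close>

lemma obtain_child_lead_Suc:
  assumes "v \<in> E1" "lead v = Suc n"
  obtains u where "u \<in> E1" "parent u = v" "lead u = n"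
proof -
  obtain z where z: "v = cycle_word (Suc n) 0 z" "z \<in> E1"
    using E1_eq_cycle_word assms by metis
  \<comment> \<open>The offset of the child has only its highest digit set.\<close>
  have c: "cycle_word (Suc n) (2 ^ (n div 2)) z = replicate n 0 @- 1 ## 1 ## z"
    using cycle_word_dilute[of n "[]" z] by simp
  have "2 ^ (n div 2) < cycle_size (Suc n)"
    using offset_dilute_less[of n "[]"] by simp
  then have "parent (cycle_word (Suc n) (2 ^ (n div 2)) z) = v"
    using parent_cycle_word(1)[of "2 ^ (n div 2)"] z(1) by (simp del: cycle_word.simps)
  moreover have "lead (cycle_word (Suc n) (2 ^ (n div 2)) z) = n"
    by (simp only: c lead_replicate)
  ultimately show thesis using that z(2) E1_cycle_word by metis
qed

section \<open>Orbits\<close>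

lemma act_inv_hang:
  assumes "d < cycle_size (lead v)"
  shows "act_inv (gen_of (lead v)) (hang v d) = hang v (if Suc d = cycle_size (lead v) then 0 else Suc d)"
    (is "_ = hang v ?d")
proof -
  have "?d < cycle_size (lead v)" "pred_mod (cycle_size (lead v)) ?d = d"
    using assms by (auto simp: pred_mod_def)
  then show ?thesis using act_hang[of ?d v] act_inv_act by metis
qed

lemma act_Bij: "act s \<in> Bij UNIV"
  by (simp add: Bij_def bij_act)

lemma basilica_Bij: "g \<in> basilica \<Longrightarrow> g \<in> Bij UNIV"
proof -
  have "carrier (BijGroup UNIV) = (Bij UNIV :: (bit stream \<Rightarrow> bit stream) set)"
    by (simp add: BijGroup_def)
  then show "g \<in> basilica \<Longrightarrow> g \<in> Bij UNIV"
    using group.generate_in_carrier[OF group_BijGroup, of "{act Gen_a, act Gen_b}" UNIV g] act_Bij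
    unfolding basilica_def by blast
qed

lemma act_inv_eq_inv: "inv\<^bsub>BijGroup UNIV\<^esub> (act s) = act_inv s"
proof -
  have "inv\<^bsub>BijGroup UNIV\<^esub> (act s) = (\<lambda>x. inv_into UNIV (act s) x)"
    using inv_BijGroup[OF act_Bij, of s] by (simp only: restrict_UNIV)
  moreover have "inv_into UNIV (act s) x = act_inv s x" for x
    by (rule inv_f_eq[OF bij_is_inj[OF bij_act] act_act_inv])
  ultimately show ?thesis by (simp only:)
qed

lemma act_in_basilica: "act s \<in> basilica" "act_inv s \<in> basilica"
proof -
  show "act s \<in> basilica"
    unfolding basilica_def by (cases s) (auto intro: generate.incl)
  show "act_inv s \<in> basilica"
    unfolding basilica_def act_inv_eq_inv[symmetric] by (cases s) (auto intro: generate.inv)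
qed

lemma basilica_comp:
  assumes gh: "g \<in> basilica" "h \<in> basilica"
  shows "(\<lambda>x. g (h x)) \<in> basilica"
proof -
  have "g \<otimes>\<^bsub>BijGroup UNIV\<^esub> h \<in> basilica"
    using gh unfolding basilica_def by (rule generate.eng)
  moreover have "g \<otimes>\<^bsub>BijGroup UNIV\<^esub> h = (\<lambda>x. g (h x))"
    using gh[THEN basilica_Bij] by (simp add: BijGroup_def compose_def restrict_def)
  ultimately show ?thesis by (simp only:)
qed

lemma orbit_self: "\<xi> \<in> basilica_orbit \<xi>"
proof -
  have "(\<lambda>x. x) \<in> basilica"
    unfolding basilica_def
    using generate.one[of "BijGroup UNIV"] by (simp add: BijGroup_def restrict_def)
  then show ?thesis unfolding basilica_orbit_def by force
qed

lemma orbit_act: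
  assumes "x \<in> basilica_orbit \<xi>"
  shows "act s x \<in> basilica_orbit \<xi>" and "act_inv s x \<in> basilica_orbit \<xi>"
proof -
  obtain g where "g \<in> basilica" "x = g \<xi>"
    using assms by (auto simp: basilica_orbit_def)
  then show "act s x \<in> basilica_orbit \<xi>" "act_inv s x \<in> basilica_orbit \<xi>"
    using basilica_comp[OF act_in_basilica(1)] basilica_comp[OF act_in_basilica(2)]
    unfolding basilica_orbit_def by fastforce+
qed

lemma orbit_induct [consumes 1, case_names self act act_inv]:
  assumes "x \<in> basilica_orbit \<xi>" "Q \<xi>"
    and "\<And>x s. Q x \<Longrightarrow> Q (act s x)" "\<And>x s. Q x \<Longrightarrow> Q (act_inv s x)"
  shows "Q x"
proof -
  obtain g where "g \<in> basilica" and x: "x = g \<xi>"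
    using assms(1) by (auto simp: basilica_orbit_def)
  have "\<forall>y. Q y \<longrightarrow> Q (g y)"
    using \<open>g \<in> basilica\<close> unfolding basilica_def
  proof (induction rule: generate.induct)
    case one
    then show ?case by (simp add: BijGroup_def)
  next
    case (incl h)
    then show ?case using assms(3) by blast
  next
    case (inv h)
    then show ?case using assms(4) by (auto simp: act_inv_eq_inv)
  next
    case (eng h1 h2)
    then have "h1 \<in> Bij UNIV" "h2 \<in> Bij UNIV"
      using basilica_Bij by (auto simp: basilica_def)
    with eng show ?case by (simp add: BijGroup_def compose_def)
  qed
  with x \<open>Q \<xi>\<close> show ?thesis by simp
qed

lemma funpow_funpow: "(f ^^ i) ((f ^^ j) x) = (f ^^ (j + i)) x"
  by (subst add.commute) (simp add: funpow_add)

lemma parent_pow_E1 [simp]: "u \<in> E1 \<Longrightarrow> (parent ^^ i) u \<in> E1"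
  by (induction i) (auto simp: hang_parent)

lemma lead_parent_pow: "u \<in> E1 \<Longrightarrow> lead u + i \<le> lead ((parent ^^ i) u)"
proof (induction i)
  case (Suc i)
  with lead_parent[of "(parent ^^ i) u"] show ?case by simp
qed simp

lemma lead_parent_pow_mono: "\<lbrakk>u \<in> E1; i < j\<rbrakk> \<Longrightarrow> lead ((parent ^^ i) u) < lead ((parent ^^ j) u)"
proof -
  assume u: "u \<in> E1" and "i < j"
  then have "(parent ^^ j) u = (parent ^^ (j - i)) ((parent ^^ i) u)"
    by (metis add.commute comp_apply funpow_add le_add_diff_inverse less_imp_le)
  then show ?thesis
    using lead_parent_pow[of "(parent ^^ i) u" "j - i"] u \<open>i < j\<close> by simp
qed

lemma parent_pow_inj: "\<lbrakk>u \<in> E1; (parent ^^ i) u = (parent ^^ j) u\<rbrakk> \<Longrightarrow> i = j"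
  using lead_parent_pow_mono[of u] by (metis less_irrefl linorder_neqE_nat)

text \<open>
Belonging to the same tree.
\<close>

definition confluent :: "bit stream \<Rightarrow> bit stream \<Rightarrow> bool" where
  "confluent x y \<longleftrightarrow> (\<exists>i j. (parent ^^ i) x = (parent ^^ j) y)"

lemma confluent_refl [simp]: "confluent x x"
  by (auto simp: confluent_def)

lemma confluent_sym: "confluent x y \<Longrightarrow> confluent y x"
  unfolding confluent_def by metis

lemma confluent_trans: "\<lbrakk>confluent x y; confluent y z\<rbrakk> \<Longrightarrow> confluent x z"
proof -
  assume "confluent x y" "confluent y z"
  then obtain i j k l where ij: "(parent ^^ i) x = (parent ^^ j) y" and kl: "(parent ^^ k) y = (parent ^^ l) z"
    unfolding confluent_def by blast
  have "(parent ^^ (k + i)) x = (parent ^^ (k + j)) y"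
    by (simp add: funpow_add ij)
  also have "\<dots> = (parent ^^ (j + l)) z"
    by (subst add.commute) (simp add: funpow_add kl)
  finally show ?thesis unfolding confluent_def by blast
qed

lemma confluent_hang: "\<lbrakk>v \<in> E1; d < cycle_size (lead v)\<rbrakk> \<Longrightarrow> confluent (hang v d) v"
  unfolding confluent_def
  by (cases "d = 0") (force intro: exI[of _ 0] exI[of _ "Suc 0"] simp: parent_hang)+

lemma confluent_act:
  assumes "x \<in> E1" shows "confluent (act s x) x"
proof -
  obtain v d where v: "v \<in> E1" "d < cycle_size (lead v)" "s = gen_of (lead v)" "x = hang v d"
    using E1_obtain_cycle assms by metis
  moreover have "pred_mod (cycle_size (lead v)) d < cycle_size (lead v)"
    using v(2) by (auto simp: pred_mod_def)
  ultimately show ?thesis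
    using act_hang confluent_hang confluent_sym confluent_trans by metis
qed

lemma confluent_act_inv:
  assumes "x \<in> E1" shows "act_inv s x \<in> E1" "confluent (act_inv s x) x"
proof -
  obtain v d where v: "v \<in> E1" "d < cycle_size (lead v)" "s = gen_of (lead v)" "x = hang v d"
    using E1_obtain_cycle assms by metis
  with act_inv_hang[of d v] show "act_inv s x \<in> E1" by simp
  then show "confluent (act_inv s x) x"
    using confluent_act[of "act_inv s x" s] confluent_sym by simp
qed

text \<open>
One generator moves through the whole cycle.
\<close>

lemma orbit_hang_iff:
  assumes "v \<in> E1" "d < cycle_size (lead v)"
  shows "hang v d \<in> basilica_orbit \<xi> \<longleftrightarrow> v \<in> basilica_orbit \<xi>"
  using assms(2)
proof (induction d)
  case 0
  then show ?case using assms(1) by simp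
next
  case (Suc d)
  then have "act (gen_of (lead v)) (hang v (Suc d)) = hang v d"
    by (simp add: act_hang pred_mod_def)
  then have "hang v (Suc d) \<in> basilica_orbit \<xi> \<longleftrightarrow> hang v d \<in> basilica_orbit \<xi>"
    using orbit_act act_inv_act by metis
  with Suc show ?case by simp
qed

lemma orbit_parent_iff: "x \<in> E1 \<Longrightarrow> parent x \<in> basilica_orbit \<xi> \<longleftrightarrow> x \<in> basilica_orbit \<xi>"
  using orbit_hang_iff[of "parent x" "offset x"] hang_parent by simp

lemma orbit_parent_pow_iff:
  "x \<in> E1 \<Longrightarrow> (parent ^^ i) x \<in> basilica_orbit \<xi> \<longleftrightarrow> x \<in> basilica_orbit \<xi>"
  by (induction i) (simp_all add: orbit_parent_iff)

text \<open>
Generators move along cycles, which does not leave the tree; conversely each vertex is connected to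
its parent along a cycle.
\<close>

lemma orbit_iff:
  assumes "\<xi> \<in> E1"
  shows "x \<in> basilica_orbit \<xi> \<longleftrightarrow> x \<in> E1 \<and> confluent x \<xi>"
proof
  assume "x \<in> basilica_orbit \<xi>"
  then show "x \<in> E1 \<and> confluent x \<xi>"
    by (induction rule: orbit_induct)
      (use assms in \<open>blast intro: confluent_refl act_E1 confluent_act confluent_act_inv confluent_trans\<close>)+
next
  assume x: "x \<in> E1 \<and> confluent x \<xi>"
  then obtain i j where "(parent ^^ i) x = (parent ^^ j) \<xi>"
    by (auto simp: confluent_def)
  then show "x \<in> basilica_orbit \<xi>"
    using orbit_self x assms orbit_parent_pow_iff by metis
qed

lemma orbit_eq:
  assumes "\<xi> \<in> E1" "\<eta> \<in> E1" "confluent \<xi> \<eta>"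
  shows "basilica_orbit \<xi> = basilica_orbit \<eta>"
  using orbit_iff assms confluent_sym confluent_trans by blast

section \<open>Vertices cut off by a vertex\<close>

definition adj :: "bit stream \<Rightarrow> bit stream \<Rightarrow> bool" where
  "adj x y \<longleftrightarrow> (\<exists>s. y = act s x \<or> x = act s y)"

text \<open>
Removing \<open>v\<close> from the graph on \<open>V\<close> leaves \<open>u\<close> in a finite component. The component itself is not
mentioned: any finite set that contains \<open>u\<close> and can only be left through \<open>v\<close> will do.
\<close>

definition cuts :: "bit stream set \<Rightarrow> bit stream \<Rightarrow> bit stream \<Rightarrow> bool" where
  "cuts V v u \<longleftrightarrow> (\<exists>S. finite S \<and> S \<subseteq> V \<and> u \<in> S \<and> v \<notin> S \<and>
     (\<forall>x\<in>S. \<forall>y\<in>V. adj x y \<longrightarrow> y \<in> S \<or> y = v))"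

text \<open>
The proper ancestors of \<open>u\<close> are those vertices through which the ray from \<open>u\<close> to the end passes.
\<close>

definition below :: "bit stream \<Rightarrow> bit stream \<Rightarrow> bool" where
  "below u v \<longleftrightarrow> (\<exists>i>0. (parent ^^ i) u = v)"

lemma act_same_cycle:
  assumes "x \<in> E1"
  obtains w d where "w \<in> E1" "d < cycle_size (lead w)" "s = gen_of (lead w)" "x = hang w d"
    "pred_mod (cycle_size (lead w)) d < cycle_size (lead w)" "act s x = hang w (pred_mod (cycle_size (lead w)) d)"
proof -
  obtain w d where w: "w \<in> E1" "d < cycle_size (lead w)" "s = gen_of (lead w)" "x = hang w d"
    using E1_obtain_cycle assms by metis
  show thesis
    by (rule that[OF w]) (use w act_hang in \<open>auto simp: pred_mod_def\<close>)
qed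

lemma adj_same_cycle:
  assumes "adj x y" "x \<in> E1" "y \<in> E1"
  obtains w d d' where "w \<in> E1" "d < cycle_size (lead w)" "d' < cycle_size (lead w)" "x = hang w d" "y = hang w d'"
  using assms unfolding adj_def by (metis act_same_cycle)

lemma below_parent:
  assumes "parent y = w" "0 < i" "(parent ^^ i) y = v"
  shows "w = v \<or> below w v"
proof -
  obtain j where "i = Suc j" using assms(2) gr0_implies_Suc by blast
  then have "(parent ^^ j) w = v"
    using assms by (simp add: funpow_Suc_right del: funpow.simps)
  then show ?thesis unfolding below_def by (cases j) auto
qed

lemma belowI: "\<lbrakk>parent y = v \<or> below (parent y) v\<rbrakk> \<Longrightarrow> below y v"
  unfolding below_def
  by (metis comp_apply funpow.simps(2) funpow_0 funpow_Suc_right zero_less_Suc)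

lemma below_iff: "below y v \<longleftrightarrow> parent y = v \<or> below (parent y) v"
  using belowI below_parent[of y "parent y" _ v] by (auto simp: below_def)

lemma lead_below: "\<lbrakk>u \<in> E1; below u v\<rbrakk> \<Longrightarrow> lead u < lead v"
  using lead_parent_pow[of u] unfolding below_def by (metis add_gr_0 add_leD2 leD less_add_same_cancel1 linorder_le_less_linear order_less_le_trans)

text \<open>
A vertex has finitely many children and their leads are smaller.
\<close>

lemma finite_below: "v \<in> E1 \<Longrightarrow> finite {x \<in> E1. below x v}"
proof (induction "lead v" arbitrary: v rule: less_induct)
  case less
  have "{x \<in> E1. below x v} \<subseteq>
    (\<Union>d\<in>{0<..<cycle_size (lead v)}. insert (hang v d) {x \<in> E1. below x (hang v d)})"
  proof clarify
    fix x assume x: "x \<in> E1" "below x v"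
    then obtain i where "(parent ^^ i) (parent x) = v"
      using gr0_implies_Suc unfolding below_def
      by (metis comp_apply funpow_Suc_right)
    then have i: "parent ((parent ^^ i) x) = v"
      by (simp add: funpow_swap1)
    let ?y = "(parent ^^ i) x"
    have "?y \<in> E1" using x by simp
    then have y: "?y = hang v (offset ?y)" "offset ?y \<in> {0<..<cycle_size (lead v)}"
      using hang_parent[of ?y] i by auto
    moreover have "x = ?y \<or> below x ?y"
      unfolding below_def by (cases i) auto
    ultimately show "x \<in> (\<Union>d\<in>{0<..<cycle_size (lead v)}. insert (hang v d) {x \<in> E1. below x (hang v d)})"
      by (intro UN_I[of "offset ?y"]) (use x in auto)
  qed
  moreover have "finite {x \<in> E1. below x (hang v d)}" if "d \<in> {0<..<cycle_size (lead v)}" for d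
    using less that lead_hang_less by simp
  ultimately show ?case
    by (auto intro: finite_subset)
qed

lemma hang_eq_cases:
  assumes "w \<in> E1" "d < cycle_size (lead w)" "x = hang w d"
  shows "x = w \<or> x \<in> E1 \<and> parent x = w \<and> offset x = d \<and> 0 < d \<and> lead x < lead w"
  using assms by (cases "d = 0") (auto simp: parent_hang offset_hang lead_hang_less)

text \<open>
An edge stays on one cycle, so it leaves the set of descendants of \<open>v\<close> only towards \<open>v\<close>.
\<close>

lemma cuts_if_below:
  assumes "\<xi> \<in> E1" "u \<in> basilica_orbit \<xi>" "v \<in> basilica_orbit \<xi>" "below u v"
  shows "cuts (basilica_orbit \<xi>) v u"
proof -
  let ?V = "basilica_orbit \<xi>"
  have E: "x \<in> E1" if "x \<in> ?V" for x
    using that assms(1) orbit_iff by blast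
  define S where "S = {x \<in> ?V. below x v}"
  have "finite S"
    unfolding S_def by (rule finite_subset[OF _ finite_below[OF E[OF assms(3)]]]) (use E in auto)
  moreover have "y \<in> S \<or> y = v" if "x \<in> S" "y \<in> ?V" "adj x y" for x y
  proof -
    have x: "x \<in> E1" "below x v" and y: "y \<in> E1"
      using that E by (auto simp: S_def)
    obtain w d d' where w: "w \<in> E1" "d < cycle_size (lead w)" "d' < cycle_size (lead w)"
      "x = hang w d" "y = hang w d'"
      using adj_same_cycle \<open>adj x y\<close> x(1) y by metis
    have "w = v \<or> below w v"
      using hang_eq_cases[OF w(1,2,4)] x(2) below_iff by metis
    then have "y = v \<or> below y v"
      using hang_eq_cases[OF w(1,3,5)] below_iff by metis
    with that show ?thesis by (auto simp: S_def)
  qed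
  moreover have "v \<notin> S"
    using lead_below[OF E[OF assms(3)]] by (auto simp: S_def)
  ultimately show ?thesis
    unfolding cuts_def using assms by (intro exI[of _ S]) (auto simp: S_def)
qed

text \<open>
If \<open>v\<close> is not an ancestor of \<open>u\<close>, the ray from \<open>u\<close> avoids \<open>v\<close>. From a vertex to its parent there are two
arcs of a cycle, and \<open>v\<close> can only block one of them. So a set that contains \<open>u\<close> and can only be left
through \<open>v\<close> contains the whole ray, which is infinite.
\<close>

lemma below_if_cuts:
  assumes "\<xi> \<in> E1" "u \<in> basilica_orbit \<xi>" "cuts (basilica_orbit \<xi>) v u"
  shows "below u v"
proof (rule ccontr)
  assume nb: "\<not> below u v"
  let ?V = "basilica_orbit \<xi>"
  have E: "x \<in> E1" if "x \<in> ?V" for x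
    using that assms(1) orbit_iff by blast
  obtain S where S: "finite S" "S \<subseteq> ?V" "u \<in> S" "v \<notin> S"
    and closed: "\<And>x y. \<lbrakk>x \<in> S; y \<in> ?V; adj x y\<rbrakk> \<Longrightarrow> y \<in> S \<or> y = v"
    using assms(3) unfolding cuts_def by blast
  have step: "parent x \<in> S" if "x \<in> S" "parent x \<noteq> v" for x
  proof -
    define w where "w = parent x"
    define N where "N = cycle_size (lead w)"
    define d where "d = offset x"
    have x: "x \<in> ?V" "x \<in> E1" using that S E by auto
    then have w: "w \<in> E1" "w \<in> ?V" and d: "0 < d" "d < N" "hang w d = x"
      using hang_parent[of x] orbit_parent_iff[of x \<xi>] by (auto simp: w_def d_def N_def)
    have inV: "hang w i \<in> ?V" if "i < N" for i
      using orbit_hang_iff[OF w(1)] w(2) that by (simp add: N_def)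
    have adj1: "adj (hang w (Suc i)) (hang w i)" "adj (hang w i) (hang w (Suc i))" if "Suc i < N" for i
      using act_hang[of "Suc i" w] that unfolding adj_def N_def by (metis diff_Suc_1 nat.simps(3) pred_mod_def)+
    have adj2: "adj (hang w (N - 1)) (hang w 0)"
      using act_hang[of 0 w] cycle_size_pos[of "lead w"] unfolding adj_def N_def pred_mod_def by metis
    show ?thesis
    \<comment> \<open>Go down from \<open>d\<close> to \<open>0\<close> unless \<open>v\<close> is on that arc; otherwise go up to \<open>N - 1\<close> and from there to \<open>0\<close>.\<close>
    proof (cases "\<exists>i<d. hang w i = v")
      case False
      have "d - i \<le> d \<Longrightarrow> hang w (d - i) \<in> S" for i
      proof (induction i)
        case (Suc i)
        show ?case
        proof (cases "i < d")
          case True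
          then have e: "d - i = Suc (d - Suc i)" by simp
          have "hang w (Suc (d - Suc i)) \<in> S" using Suc e by simp
          then have "hang w (d - Suc i) \<in> S \<or> hang w (d - Suc i) = v"
            using closed[OF _ inV adj1(1)] True d by auto
          then show ?thesis using False True by auto
        next
          case 2: False
          then show ?thesis using Suc by simp
        qed
      qed (use that d in simp)
      from this[of d] show ?thesis using w by (simp add: w_def)
    next
      case True
      then obtain i where i: "i < d" "hang w i = v" by blast
      then have "0 < i" using that w by (metis gr0I hang_0 w_def)
      have ne: "hang w j \<noteq> v" if "d \<le> j" "j < N" for j
      proof
        assume "hang w j = v"
        then have "offset (hang w j) = offset (hang w i)" using i by simp
        then show False
          using offset_hang[OF w(1), of i] offset_hang[OF w(1), of j] that \<open>0 < i\<close> i d by (simp add: N_def)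
      qed
      have "d + j < N \<Longrightarrow> hang w (d + j) \<in> S" for j
      proof (induction j)
        case (Suc j)
        then show ?case
          using closed[OF _ inV adj1(2)] ne[of "d + Suc j"] by auto
      qed (use that d in simp)
      from this[of "N - 1 - d"] have "hang w (N - 1) \<in> S" using d by simp
      then have "w \<in> S \<or> w = v" using closed[OF _ _ adj2] w by auto
      then show ?thesis using that by (simp add: w_def)
    qed
  qed
  have all: "(parent ^^ i) u \<in> S" for i
  proof (induction i)
    case (Suc i)
    have "parent ((parent ^^ i) u) \<noteq> v"
      using nb unfolding below_def by (metis comp_apply funpow.simps(2) zero_less_Suc)
    with step Suc show ?case by simp
  qed (use S in simp)
  have "inj (\<lambda>i. (parent ^^ i) u)"
    using parent_pow_inj E[OF assms(2)] by (auto simp: inj_def)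
  moreover have "finite (range (\<lambda>i. (parent ^^ i) u))"
    by (rule finite_subset[OF _ S(1)]) (use all in auto)
  ultimately show False
    using finite_imageD infinite_UNIV_nat by blast
qed

lemma cuts_iff:
  assumes "\<xi> \<in> E1" "u \<in> basilica_orbit \<xi>" "v \<in> basilica_orbit \<xi>"
  shows "cuts (basilica_orbit \<xi>) v u \<longleftrightarrow> below u v"
  using assms cuts_if_below below_if_cuts by blast

text \<open>
The cactus property: two cycles with two common vertices are equal. Comparing leads tells which of two
vertices of a cycle can be the root.
\<close>

lemma same_cycle_unique:
  assumes "hang w i \<noteq> hang w j" "hang w i = hang v d" "hang w j = hang v d'"
    and "v \<in> E1" "w \<in> E1" "i < cycle_size (lead w)" "j < cycle_size (lead w)" "d < cycle_size (lead v)" "d' < cycle_size (lead v)"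
  shows "w = v"
  using hang_eq_cases[of w i "hang w i"] hang_eq_cases[of w j "hang w j"]
    hang_eq_cases[of v d "hang w i"] hang_eq_cases[of v d' "hang w j"] assms
  by (smt (verit) less_asym)

lemma hang_inj:
  assumes "hang w i = hang w j" "w \<in> E1" "i < cycle_size (lead w)" "j < cycle_size (lead w)"
  shows "i = j"
proof -
  obtain z where z: "w = cycle_word (lead w) 0 z" using E1_eq_cycle_word assms(2) by blast
  then have "\<And>d. hang w d = cycle_word (lead w) d z" by (metis hang_cycle_word)
  then show ?thesis using assms cycle_word_inj by metis
qed

text \<open>
A cycle has no chords.
\<close>

lemma adj_hang:
  assumes "adj (hang w i) (hang w j)" "i \<noteq> j" "w \<in> E1" "i < cycle_size (lead w)" "j < cycle_size (lead w)"
  shows "j = pred_mod (cycle_size (lead w)) i \<or> i = pred_mod (cycle_size (lead w)) j"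
proof -
  have *: "j = pred_mod (cycle_size (lead w)) i" if "hang w j = act s (hang w i)" "i \<noteq> j" "i < cycle_size (lead w)" "j < cycle_size (lead w)" for s i j
  proof -
    obtain v d where v: "v \<in> E1" "d < cycle_size (lead v)" "s = gen_of (lead v)" "hang w i = hang v d"
      "pred_mod (cycle_size (lead v)) d < cycle_size (lead v)" "act s (hang w i) = hang v (pred_mod (cycle_size (lead v)) d)"
      using act_same_cycle[OF hang_E1[OF assms(3)]] by metis
    have "hang w i \<noteq> hang w j" using hang_inj that assms(3) by blast
    then have "w = v"
      using same_cycle_unique v that assms(3) by metis
    then show ?thesis using v that hang_inj assms(3) by metis
  qed
  show ?thesis using assms(1) *[of j _ i] *[of i _ j] assms(2,4,5) unfolding adj_def by auto
qed

text \<open>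
An injective map of the cycle of length \<open>N\<close> to itself that fixes \<open>0\<close> and preserves adjacency is the
identity or the reflection: the image of \<open>1\<close> decides on the direction, which cannot change since the
map is injective.
\<close>

lemma cyclic_neighbour_map:
  fixes q :: "nat \<Rightarrow> nat"
  assumes q0: "q 0 = 0" and inj: "inj_on q {..<N}" and less: "\<And>d. d < N \<Longrightarrow> q d < N"
    and nb: "\<And>d. Suc d < N \<Longrightarrow> q (Suc d) = pred_mod N (q d) \<or> q d = pred_mod N (q (Suc d))"
    and d: "0 < d" "d < N"
  shows "q d = d \<or> q d = N - d"
proof -
  have ne: "q i \<noteq> q j" if "i < j" "j < N" for i j
    using inj_onD[OF inj, of i j] that by auto
  have q1: "q 1 = 1 \<or> q 1 = N - 1"
    using nb[of 0] ne[of 0 1] less[of 1] d q0 by (auto simp: pred_mod_def split: if_splits)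
  obtain c where c: "d = Suc c" using d gr0_implies_Suc by blast
  from q1 show ?thesis
  proof
    assume "q 1 = 1"
    have "Suc i < N \<Longrightarrow> q i = i \<and> q (Suc i) = Suc i" for i
    proof (induction i)
      case (Suc i)
      then show ?case
        using nb[of "Suc i"] ne[of i "Suc (Suc i)"] less[of "Suc (Suc i)"] by (auto simp: pred_mod_def split: if_splits)
    qed (use q0 \<open>q 1 = 1\<close> in simp)
    with d c show ?thesis by simp
  next
    assume "q 1 = N - 1"
    have "Suc i < N \<Longrightarrow> (0 < i \<longrightarrow> q i = N - i) \<and> q (Suc i) = N - Suc i" for i
    proof (induction i)
      case (Suc i)
      then show ?case
        using nb[of "Suc i"] ne[of i "Suc (Suc i)"] ne[of 0 "Suc (Suc i)"] less[of "Suc (Suc i)"] q0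
        by (cases "i = 0") (auto simp: pred_mod_def split: if_splits)
    qed (use \<open>q 1 = N - 1\<close> in simp)
    with d c show ?thesis by simp
  qed
qed

section \<open>Isomorphisms respect the tree\<close>

text \<open>
The lead in the last line is that of the root of the cycle on which the offset is measured, so that
the two sides of the disjunction are equality of offsets and equality up to reflection.
\<close>

definition matching :: "bit stream \<Rightarrow> bit stream \<Rightarrow> bool" where
  "matching u v \<longleftrightarrow> (\<forall>l. lead ((parent ^^ l) u) = lead ((parent ^^ l) v) \<and>
     (offset ((parent ^^ l) v) = offset ((parent ^^ l) u) \<or>
      offset ((parent ^^ l) v) = cycle_size (lead ((parent ^^ Suc l) u)) - offset ((parent ^^ l) u)))"

lemma multigraph_iso_adj:
  assumes "schreier \<xi> \<simeq> schreier \<eta>"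
  obtains f where "bij_betw f (basilica_orbit \<xi>) (basilica_orbit \<eta>)"
    and "\<And>x y. \<lbrakk>x \<in> basilica_orbit \<xi>; y \<in> basilica_orbit \<xi>\<rbrakk> \<Longrightarrow> adj x y \<longleftrightarrow> adj (f x) (f y)"
proof -
  let ?V = "basilica_orbit \<xi>" and ?W = "basilica_orbit \<eta>"
  obtain f g where f: "bij_betw f ?V ?W" and g: "bij_betw g (?V \<times> UNIV) (?W \<times> UNIV)"
    and ends: "\<And>x s. x \<in> ?V \<Longrightarrow> (\<lambda>(x, s). {x, act s x}) (g (x, s)) = f ` {x, act s x}"
    using assms by (auto simp: multigraph_iso_def schreier_def)
  have ad: "adj x y \<longleftrightarrow> (\<exists>z s. z \<in> U \<and> {x, y} = {z, act s z})" if "x \<in> U" "y \<in> U" for x y U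
    using that unfolding adj_def doubleton_eq_iff by metis
  have "adj x y \<longleftrightarrow> adj (f x) (f y)" if xy: "x \<in> ?V" "y \<in> ?V" for x y
  proof
    assume "adj x y"
    then obtain z s where z: "z \<in> ?V" "{x, y} = {z, act s z}" using ad[OF xy] by blast
    obtain z' s' where gz: "g (z, s) = (z', s')" by fastforce
    have "{f x, f y} = f ` {z, act s z}" unfolding z(2)[symmetric] by simp
    also have "\<dots> = {z', act s' z'}"
      using ends[OF z(1), of s] gz by simp
    finally have "f x = z' \<and> f y = act s' z' \<or> f x = act s' z' \<and> f y = z'"
      by (simp only: doubleton_eq_iff)
    then show "adj (f x) (f y)"
      unfolding adj_def by metis
  next
    assume "adj (f x) (f y)"
    moreover have fxy: "f x \<in> ?W" "f y \<in> ?W" using xy bij_betwE[OF f] by blast+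
    ultimately have "\<exists>z' s'. z' \<in> ?W \<and> {f x, f y} = {z', act s' z'}"
      using ad[OF fxy] by (simp only:)
    then obtain z' s' where z': "z' \<in> ?W" "{f x, f y} = {z', act s' z'}" by blast
    then have "(z', s') \<in> g ` (?V \<times> UNIV)"
      using bij_betw_imp_surj_on[OF g] by simp
    then obtain p where "p \<in> ?V \<times> UNIV" "(z', s') = g p" by (rule imageE)
    then obtain z s where z: "z \<in> ?V" "g (z, s) = (z', s')" by (metis SigmaE)
    have "f ` {z, act s z} = {z', act s' z'}"
      using ends[OF z(1), of s] unfolding z(2) prod.case by (rule sym)
    then have "f ` {x, y} = f ` {z, act s z}"
      unfolding image_insert[of f x] image_insert[of f y] image_empty z'(2) by (rule sym)
    moreover have "{x, y} \<subseteq> ?V" "{z, act s z} \<subseteq> ?V" using xy z orbit_act by auto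
    ultimately have "{x, y} = {z, act s z}"
      using inj_on_image_eq_iff[OF bij_betw_imp_inj_on[OF f]] by blast
    with z(1) have "\<exists>z s. z \<in> ?V \<and> {x, y} = {z, act s z}" by (intro exI conjI)
    then show "adj x y" using ad[OF xy] by (simp only:)
  qed
  with f that show thesis by blast
qed

locale cactus_iso =
  fixes \<xi> \<eta> :: "bit stream" and f :: "bit stream \<Rightarrow> bit stream"
  assumes E1: "\<xi> \<in> E1" "\<eta> \<in> E1"
    and bij: "bij_betw f (basilica_orbit \<xi>) (basilica_orbit \<eta>)"
    and adj_iff: "\<And>x y. \<lbrakk>x \<in> basilica_orbit \<xi>; y \<in> basilica_orbit \<xi>\<rbrakk> \<Longrightarrow> adj x y \<longleftrightarrow> adj (f x) (f y)"
begin

abbreviation "V \<equiv> basilica_orbit \<xi>"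
abbreviation "W \<equiv> basilica_orbit \<eta>"

lemma V_E1: "x \<in> V \<Longrightarrow> x \<in> E1" and W_E1: "y \<in> W \<Longrightarrow> y \<in> E1"
  using E1 orbit_iff by blast+

lemma f_W: "x \<in> V \<Longrightarrow> f x \<in> W"
  using bij by (auto simp: bij_betw_def)

lemma f_inj: "\<lbrakk>x \<in> V; y \<in> V\<rbrakk> \<Longrightarrow> f x = f y \<longleftrightarrow> x = y"
  using bij by (auto simp: bij_betw_def inj_on_def)

lemma f_surj: "y \<in> W \<Longrightarrow> \<exists>x\<in>V. f x = y"
  using bij by (metis bij_betw_imp_surj_on imageE)

lemma f_below_iff:
  assumes "u \<in> V" "v \<in> V"
  shows "below (f u) (f v) \<longleftrightarrow> below u v"
proof -
  have "cuts W (f v) (f u) \<longleftrightarrow> cuts V v u"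
  proof
    assume "cuts V v u"
    then obtain S where S: "finite S" "S \<subseteq> V" "u \<in> S" "v \<notin> S"
      "\<forall>x\<in>S. \<forall>y\<in>V. adj x y \<longrightarrow> y \<in> S \<or> y = v"
      unfolding cuts_def by blast
    have "y \<in> f ` S \<or> y = f v" if xy: "x \<in> f ` S" "y \<in> W" "adj x y" for x y
    proof -
      obtain x' y' where "x' \<in> S" "x = f x'" "y' \<in> V" "y = f y'"
        using f_surj xy by blast
      then show ?thesis using S(2,5) adj_iff xy(3) by blast
    qed
    then show "cuts W (f v) (f u)"
      unfolding cuts_def
      by (intro exI[of _ "f ` S"]) (use S f_W f_inj assms in \<open>auto simp: subset_iff\<close>)
  next
    assume "cuts W (f v) (f u)"
    then obtain S where S: "finite S" "S \<subseteq> W" "f u \<in> S" "f v \<notin> S"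
      "\<forall>x\<in>S. \<forall>y\<in>W. adj x y \<longrightarrow> y \<in> S \<or> y = f v"
      unfolding cuts_def by blast
    have "finite {x \<in> V. f x \<in> S}"
      using finite_vimage_IntI[OF S(1), of f V] bij
      by (auto simp: bij_betw_def vimage_def Int_def conj_commute)
    then show "cuts V v u"
      unfolding cuts_def using S assms f_W f_inj adj_iff
      by (intro exI[of _ "{x \<in> V. f x \<in> S}"]) (auto, blast)
  qed
  then show ?thesis
    using cuts_iff E1 assms f_W by blast
qed

lemma parent_V: "x \<in> V \<Longrightarrow> parent x \<in> V" and parent_W: "y \<in> W \<Longrightarrow> parent y \<in> W"
  using V_E1 W_E1 orbit_parent_iff by blast+

text \<open>
The parent is the nearest ancestor, and being an ancestor is a property of the graph by \<open>cuts_iff\<close>.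
\<close>

lemma f_parent:
  assumes "u \<in> V"
  shows "f (parent u) = parent (f u)"
proof -
  have "below u (parent u)" using below_iff by blast
  then have "below (f u) (f (parent u))"
    using f_below_iff assms parent_V by blast
  then consider "parent (f u) = f (parent u)" | "below (parent (f u)) (f (parent u))"
    using below_iff by blast
  then show ?thesis
  proof cases
    case 2
    obtain x where x: "x \<in> V" "f x = parent (f u)"
      using f_surj f_W assms parent_W by metis
    then have "below (f u) (f x)" using below_iff by metis
    then have "below u x" using f_below_iff assms x by blast
    moreover have "below x (parent u)"
      using 2 f_below_iff x assms parent_V by metis
    ultimately have False
      using below_iff lead_below V_E1 x parent_V assms less_asym less_irrefl by metis
    then show ?thesis ..
  qed simp
qed

lemma f_parent_pow: "u \<in> V \<Longrightarrow> f ((parent ^^ i) u) = (parent ^^ i) (f u)"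
  by (induction i) (use f_parent orbit_parent_pow_iff V_E1 in auto)

end

text \<open>
The lead is the height of the subtree below a vertex: it increases strictly along rays, and a vertex
of lead \<open>n + 1\<close> has a child of lead \<open>n\<close>.
\<close>

lemma lead_ge_iff:
  assumes "\<xi> \<in> E1" "v \<in> basilica_orbit \<xi>"
  shows "h \<le> lead v \<longleftrightarrow> (\<exists>u\<in>basilica_orbit \<xi>. (parent ^^ h) u = v)"
  using assms(2)
proof (induction h arbitrary: v)
  case (Suc h)
  have E: "x \<in> E1" if "x \<in> basilica_orbit \<xi>" for x
    using that assms(1) orbit_iff by blast
  show ?case
  proof
    assume "Suc h \<le> lead v"
    then obtain n where n: "lead v = Suc n" "h \<le> n" using Suc_le_D by auto
    obtain u where u: "u \<in> E1" "parent u = v" "lead u = n"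
      using obtain_child_lead_Suc[OF E[OF Suc.prems] n(1)] by blast
    then have "u \<in> basilica_orbit \<xi>" using Suc.prems orbit_parent_iff by blast
    then obtain w where "w \<in> basilica_orbit \<xi>" "(parent ^^ h) w = u"
      using Suc.IH u n by blast
    with u show "\<exists>u\<in>basilica_orbit \<xi>. (parent ^^ Suc h) u = v" by auto
  next
    assume "\<exists>u\<in>basilica_orbit \<xi>. (parent ^^ Suc h) u = v"
    then obtain u where "u \<in> basilica_orbit \<xi>" "(parent ^^ Suc h) u = v" by blast
    then show "Suc h \<le> lead v"
      using lead_parent_pow[OF E, of u "Suc h"] by simp
  qed
qed auto

context cactus_iso
begin

lemma f_lead:
  assumes "v \<in> V"
  shows "lead (f v) = lead v"
proof -
  have "h \<le> lead (f v) \<longleftrightarrow> h \<le> lead v" for h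
  proof -
    have "(\<exists>w\<in>W. (parent ^^ h) w = f v) \<longleftrightarrow> (\<exists>u\<in>V. f ((parent ^^ h) u) = f v)"
      using f_surj f_W f_parent_pow by metis
    also have "\<dots> \<longleftrightarrow> (\<exists>u\<in>V. (parent ^^ h) u = v)"
      using f_inj orbit_parent_pow_iff V_E1 assms by metis
    finally show ?thesis
      using lead_ge_iff E1 assms f_W by metis
  qed
  then show ?thesis by (meson le_antisym order_refl)
qed

text \<open>
The cycle hanging from a vertex consists of the vertex and its children, so it is mapped onto the
cycle hanging from the image, respecting adjacency.
\<close>

lemma f_offset:
  assumes "u \<in> V"
  shows "offset (f u) = offset u \<or> offset (f u) = cycle_size (lead (parent u)) - offset u"
proof -
  define v where "v = parent u"
  define N where "N = cycle_size (lead v)"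
  define q where "q d = (if d = 0 then 0 else offset (f (hang v d)))" for d
  have v: "v \<in> V" "v \<in> E1" using assms parent_V V_E1 by (auto simp: v_def)
  have w: "f v \<in> E1" "N = cycle_size (lead (f v))"
    using v f_W W_E1 f_lead by (auto simp: N_def)
  have inV: "hang v d \<in> V" if "d < N" for d
    using orbit_hang_iff[OF v(2)] v(1) that by (simp add: N_def)
  have q: "f (hang v d) = hang (f v) (q d) \<and> q d < N" if "d < N" for d
  proof (cases "d = 0")
    case True
    then show ?thesis using v w by (simp add: q_def N_def)
  next
    case False
    have "parent (hang v d) = v" using False that parent_hang v(2) by (simp add: N_def)
    then have "parent (f (hang v d)) = f v"
      using f_parent[OF inV[OF that]] by simp
    then show ?thesis
      using hang_parent[OF W_E1[OF f_W[OF inV[OF that]]]] False w(2) by (simp add: q_def)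
  qed
  have q0: "q 0 = 0" by (simp add: q_def)
  have qinj: "inj_on q {..<N}"
  proof (rule inj_onI)
    fix i j assume "i \<in> {..<N}" "j \<in> {..<N}" "q i = q j"
    then have ij: "i < N" "j < N" "f (hang v i) = f (hang v j)" using q by auto
    then show "i = j" using f_inj inV hang_inj[OF _ v(2)] by (metis N_def)
  qed
  have nb: "q (Suc d) = pred_mod N (q d) \<or> q d = pred_mod N (q (Suc d))" if "Suc d < N" for d
  proof -
    have "act (gen_of (lead v)) (hang v (Suc d)) = hang v d"
      using that act_hang[of "Suc d" v] by (simp add: pred_mod_def N_def)
    then have "adj (hang v d) (hang v (Suc d))" unfolding adj_def by metis
    then have a: "adj (hang (f v) (q d)) (hang (f v) (q (Suc d)))"
      using adj_iff inV q that by (metis Suc_lessD)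
    have "q d \<noteq> q (Suc d)" using inj_onD[OF qinj, of d "Suc d"] that by auto
    from adj_hang[OF a this w(1)] q that w(2) show ?thesis by (metis Suc_lessD)
  qed
  have u: "hang v (offset u) = u" "0 < offset u" "offset u < N"
    using hang_parent[OF V_E1[OF assms]] by (auto simp: v_def N_def)
  then have "q (offset u) = offset (f u)" by (simp add: q_def)
  then show ?thesis
    using cyclic_neighbour_map[OF q0 qinj _ nb u(2,3)] q by (simp add: N_def v_def)
qed

lemma matching_image:
  assumes "u \<in> V" shows "matching u (f u)"
  unfolding matching_def
proof (intro allI conjI)
  fix l
  have V: "(parent ^^ l) u \<in> V"
    using orbit_parent_pow_iff[OF V_E1[OF assms]] assms by blast
  show "lead ((parent ^^ l) u) = lead ((parent ^^ l) (f u))"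
    using f_lead[OF V] f_parent_pow[OF assms] by simp
  show "offset ((parent ^^ l) (f u)) = offset ((parent ^^ l) u) \<or>
      offset ((parent ^^ l) (f u)) = cycle_size (lead ((parent ^^ Suc l) u)) - offset ((parent ^^ l) u)"
    using f_offset[OF V] f_parent_pow[OF assms] by simp
qed

end

lemma matching_parent_pow: "matching u v \<Longrightarrow> matching ((parent ^^ i) u) ((parent ^^ i) v)"
  unfolding matching_def funpow_funpow by simp

lemma matching_if_iso:
  assumes "\<xi> \<in> E1" "\<eta> \<in> E1" "schreier \<xi> \<simeq> schreier \<eta>"
  shows "\<exists>i j. matching ((parent ^^ i) \<xi>) ((parent ^^ j) \<eta>)"
proof -
  obtain f where f: "cactus_iso \<xi> \<eta> f"
    using multigraph_iso_adj[OF assms(3)] assms(1,2) unfolding cactus_iso_def by metis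
  then have "matching \<xi> (f \<xi>)" "f \<xi> \<in> basilica_orbit \<eta>"
    using cactus_iso.matching_image cactus_iso.f_W orbit_self by metis+
  then obtain i j where "(parent ^^ i) (f \<xi>) = (parent ^^ j) \<eta>"
    using orbit_iff[OF assms(2)] by (auto simp: confluent_def)
  with matching_parent_pow[OF \<open>matching \<xi> (f \<xi>)\<close>, of i] show ?thesis by metis
qed

section \<open>Extending a match of rays to an isomorphism\<close>

text \<open>
An isomorphism is built from the rays of \<open>v\<close> and \<open>w\<close>. It sends the ray of \<open>v\<close> to the ray of \<open>w\<close> and is
continued from parents to children, keeping offsets, except that a cycle is reflected if the rays of
\<open>v\<close> and \<open>w\<close> enter it and its counterpart at different offsets.
\<close>

locale matching_rays =
  fixes v w :: "bit stream"
  assumes E1: "v \<in> E1" "w \<in> E1" and matching: "matching v w"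
begin

definition on_ray :: "bit stream \<Rightarrow> bool" where
  "on_ray u \<longleftrightarrow> (\<exists>l. u = (parent ^^ l) v)"

definition flip :: "bit stream \<Rightarrow> bool" where
  "flip x \<longleftrightarrow> (\<exists>l. x = (parent ^^ Suc l) v \<and> offset ((parent ^^ l) w) \<noteq> offset ((parent ^^ l) v))"

text \<open>
The vertex \<open>0\<close> of the cycle is fixed by the reflection.
\<close>

definition turn :: "bit stream \<Rightarrow> nat \<Rightarrow> nat" where
  "turn x d = (if flip x \<and> d \<noteq> 0 then cycle_size (lead x) - d else d)"

text \<open>
The argument counts how many steps up the tree lead to the ray.
\<close>

fun transport :: "nat \<Rightarrow> bit stream \<Rightarrow> bit stream" where
  "transport 0 u = (parent ^^ (THE l. u = (parent ^^ l) v)) w"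
| "transport (Suc n) u = hang (transport n (parent u)) (turn (parent u) (offset u))"

definition dist_ray :: "bit stream \<Rightarrow> nat" where
  "dist_ray u = (LEAST n. on_ray ((parent ^^ n) u))"

definition ray_map :: "bit stream \<Rightarrow> bit stream" where
  "ray_map u = transport (dist_ray u) u"

abbreviation "V \<equiv> basilica_orbit v"
abbreviation "W \<equiv> basilica_orbit w"

lemma V_E1: "x \<in> V \<Longrightarrow> x \<in> E1" and W_E1: "y \<in> W \<Longrightarrow> y \<in> E1"
  using E1 orbit_iff by blast+

lemma parent_V: "x \<in> V \<Longrightarrow> parent x \<in> V" and parent_W: "y \<in> W \<Longrightarrow> parent y \<in> W"
  using V_E1 W_E1 orbit_parent_iff by blast+

lemma V_ray: "u \<in> V \<Longrightarrow> \<exists>n. on_ray ((parent ^^ n) u)"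
  using orbit_iff[OF E1(1)] by (auto simp: confluent_def on_ray_def)

lemma on_ray_parent: "on_ray u \<Longrightarrow> on_ray (parent u)"
  unfolding on_ray_def by (metis comp_apply funpow.simps(2))

lemma on_ray_parent_pow: "n \<le> m \<Longrightarrow> on_ray ((parent ^^ n) u) \<Longrightarrow> on_ray ((parent ^^ m) u)"
  by (induction m rule: dec_induct) (auto intro: on_ray_parent)

lemma ray_induct [consumes 1, case_names ray parent]:
  assumes "u \<in> V"
    and "\<And>l. Q ((parent ^^ l) v)"
    and "\<And>u. \<lbrakk>u \<in> V; Q (parent u)\<rbrakk> \<Longrightarrow> Q u"
  shows "Q u"
proof -
  obtain n where "on_ray ((parent ^^ n) u)" using V_ray assms(1) by blast
  then show ?thesis using assms(1)
  proof (induction n arbitrary: u)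
    case 0
    then show ?case using assms(2) by (auto simp: on_ray_def)
  next
    case (Suc n)
    then have "on_ray ((parent ^^ n) (parent u))" by (simp add: funpow_swap1)
    then show ?case using Suc parent_V assms(3) by blast
  qed
qed

lemma ray_map_ray: "ray_map ((parent ^^ l) v) = (parent ^^ l) w"
proof -
  have "dist_ray ((parent ^^ l) v) = 0"
    unfolding dist_ray_def by (rule Least_equality) (auto simp: on_ray_def)
  moreover have "(THE l'. (parent ^^ l) v = (parent ^^ l') v) = l"
    using parent_pow_inj[OF E1(1)] by (intro the_equality) auto
  ultimately show ?thesis by (simp add: ray_map_def)
qed

lemma turn_ray: "turn ((parent ^^ Suc l) v) (offset ((parent ^^ l) v)) = offset ((parent ^^ l) w)"
proof -
  have "flip ((parent ^^ Suc l) v) \<longleftrightarrow> offset ((parent ^^ l) w) \<noteq> offset ((parent ^^ l) v)"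
    unfolding flip_def using parent_pow_inj[OF E1(1), of "Suc l"] by (metis nat.inject)
  moreover have "0 < offset ((parent ^^ l) v)"
    using hang_parent parent_pow_E1 E1 by blast
  ultimately show ?thesis
    using matching unfolding matching_def turn_def by (metis less_irrefl)
qed

text \<open>
Off the ray this is the recursion; on the ray it holds as \<open>flip\<close> was chosen so that \<open>turn\<close> takes the
offsets along the ray of \<open>v\<close> to those along the ray of \<open>w\<close>.
\<close>

lemma ray_map_unfold:
  assumes "u \<in> V"
  shows "ray_map u = hang (ray_map (parent u)) (turn (parent u) (offset u))"
proof (cases "on_ray u")
  case True
  then obtain l where l: "u = (parent ^^ l) v" by (auto simp: on_ray_def)
  have "ray_map (parent u) = parent ((parent ^^ l) w)"
    using ray_map_ray[of "Suc l"] by (simp add: l)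
  moreover have "turn (parent u) (offset u) = offset ((parent ^^ l) w)"
    using turn_ray[of l] by (simp add: l)
  ultimately show ?thesis
    using hang_parent(2)[of "(parent ^^ l) w"] ray_map_ray[of l] E1 by (simp add: l)
next
  case False
  obtain n where "on_ray ((parent ^^ n) u)" using V_ray assms by blast
  then have "dist_ray u = Suc (LEAST n. on_ray ((parent ^^ Suc n) u))"
    unfolding dist_ray_def by (rule Least_Suc) (use False in simp)
  then have "dist_ray u = Suc (dist_ray (parent u))"
    by (simp add: dist_ray_def funpow_swap1)
  then show ?thesis by (simp add: ray_map_def)
qed

lemma turn_less: "d < cycle_size (lead x) \<Longrightarrow> turn x d < cycle_size (lead x)"
  and turn_pos: "0 < d \<Longrightarrow> d < cycle_size (lead x) \<Longrightarrow> 0 < turn x d"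
  and turn_turn: "d < cycle_size (lead x) \<Longrightarrow> turn x (turn x d) = d"
  and turn_0 [simp]: "turn x 0 = 0"
  by (auto simp: turn_def)

lemma lead_hang_turn:
  assumes "x \<in> E1" "0 < d" "d < cycle_size (lead x)" "lead y = lead x"
  shows "lead (hang y (turn x d)) = lead (hang x d)"
  using lead_hang_cong[OF assms] lead_hang_neg[OF assms] by (simp add: turn_def)

lemma ray_map_W_lead: "u \<in> V \<Longrightarrow> ray_map u \<in> W \<and> lead (ray_map u) = lead u"
proof (induction rule: ray_induct)
  case (ray l)
  then show ?case
    using ray_map_ray[of l] matching orbit_parent_pow_iff[OF E1(2), of l w] orbit_self
    by (auto simp: matching_def)
next
  case (parent u)
  let ?x = "parent u"
  have u: "hang ?x (offset u) = u" "0 < offset u" "offset u < cycle_size (lead ?x)" "?x \<in> E1"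
    using hang_parent V_E1 parent(1) by blast+
  have "hang (ray_map ?x) (turn ?x (offset u)) \<in> W"
    using orbit_hang_iff[of "ray_map ?x"] parent(2) turn_less[OF u(3)] W_E1 by simp
  moreover have "lead (hang (ray_map ?x) (turn ?x (offset u))) = lead u"
    using lead_hang_turn[OF u(4,2,3)] parent(2) u(1) by simp
  ultimately show ?case using ray_map_unfold[OF parent(1)] by simp
qed

lemma ray_map_hang:
  assumes "x \<in> V" "d < cycle_size (lead x)"
  shows "ray_map (hang x d) = hang (ray_map x) (turn x d)"
proof (cases "d = 0")
  case True
  then show ?thesis using assms V_E1 W_E1 ray_map_W_lead by simp
next
  case False
  then have "parent (hang x d) = x" "offset (hang x d) = d"
    using parent_hang offset_hang V_E1 assms by auto
  moreover have "hang x d \<in> V" using orbit_hang_iff V_E1 assms by blast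
  ultimately show ?thesis using ray_map_unfold by metis
qed

lemma parent_ray_map: "u \<in> V \<Longrightarrow> parent (ray_map u) = ray_map (parent u)"
  and offset_ray_map: "u \<in> V \<Longrightarrow> offset (ray_map u) = turn (parent u) (offset u)"
proof -
  assume u: "u \<in> V"
  have x: "ray_map (parent u) \<in> E1" "lead (ray_map (parent u)) = lead (parent u)"
    using ray_map_W_lead parent_V u W_E1 by blast+
  have d: "0 < turn (parent u) (offset u)" "turn (parent u) (offset u) < cycle_size (lead (ray_map (parent u)))"
    using hang_parent[OF V_E1[OF u]] turn_less turn_pos x(2) by simp_all
  show "parent (ray_map u) = ray_map (parent u)" "offset (ray_map u) = turn (parent u) (offset u)"
    unfolding ray_map_unfold[OF u] using parent_hang[OF x(1) d] offset_hang[OF x(1) d] by auto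
qed

text \<open>
The map commutes with parents and acts bijectively on the offsets below each vertex. So both injectivity and
surjectivity descend from the rays, which all vertices eventually reach.
\<close>

lemma bij_ray_map: "bij_betw ray_map V W"
proof (rule bij_betwI')
  fix x y assume x: "x \<in> V" and y: "y \<in> V"
  obtain m n where mn: "on_ray ((parent ^^ m) x)" "on_ray ((parent ^^ n) y)"
    using V_ray x y by metis
  define k where "k = max m n"
  have "on_ray ((parent ^^ k) x)" "on_ray ((parent ^^ k) y)"
    using on_ray_parent_pow[OF _ mn(1)] on_ray_parent_pow[OF _ mn(2)] by (simp_all add: k_def)
  then have "ray_map x = ray_map y \<Longrightarrow> x = y"
    using x y
  proof (induction k arbitrary: x y)
    case 0
    then obtain l l' where l: "x = (parent ^^ l) v" "y = (parent ^^ l') v"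
      by (auto simp: on_ray_def)
    then have "(parent ^^ l) w = (parent ^^ l') w" using 0 ray_map_ray by simp
    then show ?case using parent_pow_inj[OF E1(2)] l by blast
  next
    case (Suc k)
    have "ray_map (parent x) = ray_map (parent y)"
      using Suc.prems parent_ray_map by metis
    then have p: "parent x = parent y"
      using Suc.IH Suc.prems parent_V by (simp add: funpow_swap1)
    have "turn (parent x) (offset x) = turn (parent x) (offset y)"
      using offset_ray_map Suc.prems p by metis
    then have "offset x = offset y"
      using turn_turn hang_parent V_E1 Suc.prems p by metis
    then show ?case using p hang_parent V_E1 Suc.prems by metis
  qed
  then show "ray_map x = ray_map y \<longleftrightarrow> x = y" by blast
next
  show "x \<in> V \<Longrightarrow> ray_map x \<in> W" for x using ray_map_W_lead by blast
next
  have *: "(parent ^^ n) y = (parent ^^ l) w \<Longrightarrow> y \<in> W \<Longrightarrow> \<exists>x\<in>V. y = ray_map x" for n l y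
  proof (induction n arbitrary: y)
    case 0
    then show ?case
      using ray_map_ray[of l] orbit_parent_pow_iff[OF E1(1), of l v] orbit_self[of v] by (metis funpow_0)
  next
    case (Suc n)
    then obtain x where x: "x \<in> V" "parent y = ray_map x"
      using parent_W by (metis comp_apply funpow_Suc_right)
    let ?d = "offset y"
    have d: "?d < cycle_size (lead x)" "hang (ray_map x) ?d = y"
      using hang_parent[OF W_E1[OF Suc.prems(2)]] x ray_map_W_lead by auto
    then have "ray_map (hang x (turn x ?d)) = y"
      using ray_map_hang[OF x(1) turn_less] turn_turn by simp
    moreover have "hang x (turn x ?d) \<in> V"
      using orbit_hang_iff[OF V_E1[OF x(1)] turn_less] x(1) d by blast
    ultimately show ?case by metis
  qed
  show "\<exists>x\<in>V. y = ray_map x" if "y \<in> W" for y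
    using that * orbit_iff[OF E1(2)] unfolding confluent_def by blast
qed

definition cycle_root :: "bit stream \<Rightarrow> gen \<Rightarrow> bit stream" where
  "cycle_root x s = (if s = gen_of (lead x) then x else parent x)"

lemma cycle_root_hang:
  assumes "y \<in> E1" "d < cycle_size (lead y)"
  shows "cycle_root (hang y d) (gen_of (lead y)) = y"
proof (cases "d = 0")
  case False
  then have "even (lead (hang y d)) \<longleftrightarrow> odd (lead y)" "parent (hang y d) = y"
    using even_lead_hang[of y d] parent_hang assms by auto
  then show ?thesis by (auto simp: cycle_root_def gen_of_def)
qed (use assms in \<open>simp add: cycle_root_def\<close>)

lemma ray_map_act:
  assumes "x \<in> V"
  shows "cycle_root (act s x) s = cycle_root x s"
    and "\<not> flip (cycle_root x s) \<Longrightarrow> ray_map (act s x) = act s (ray_map x)"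
    and "flip (cycle_root x s) \<Longrightarrow> act s (ray_map (act s x)) = ray_map x"
proof -
  obtain y d where y: "y \<in> E1" "d < cycle_size (lead y)" "s = gen_of (lead y)" "x = hang y d"
    "pred_mod (cycle_size (lead y)) d < cycle_size (lead y)" "act s x = hang y (pred_mod (cycle_size (lead y)) d)"
    using act_same_cycle V_E1 assms by metis
  define N where "N = cycle_size (lead y)"
  have yV: "y \<in> V" using orbit_hang_iff y assms by metis
  have r: "cycle_root x s = y" "cycle_root (act s x) s = y"
    using cycle_root_hang[OF y(1)] y by metis+
  then show "cycle_root (act s x) s = cycle_root x s" by simp
  have fx: "ray_map x = hang (ray_map y) (turn y d)" "ray_map (act s x) = hang (ray_map y) (turn y (pred_mod N d))"
    using ray_map_hang[OF yV] y by (auto simp: N_def)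
  have l: "lead (ray_map y) = lead y" using ray_map_W_lead yV by blast
  have act_f: "act s (hang (ray_map y) i) = hang (ray_map y) (pred_mod N i)" if "i < N" for i
    using act_hang[of i "ray_map y"] that y(3) l by (simp add: N_def)
  show "ray_map (act s x) = act s (ray_map x)" if "\<not> flip (cycle_root x s)"
    using that act_f[of d] fx y(2) by (simp add: r turn_def N_def)
  show "act s (ray_map (act s x)) = ray_map x" if "flip (cycle_root x s)"
  proof -
    have "pred_mod N (turn y (pred_mod N d)) = turn y d"
      using that y(2) by (auto simp: r turn_def N_def pred_mod_def)
    then show ?thesis
      using act_f[of "turn y (pred_mod N d)"] fx turn_less y(5) by (simp add: N_def)
  qed
qed

text \<open>
On a reflected cycle the map reverses the direction of the generator, so the edge from \<open>x\<close> to \<open>act s x\<close>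
goes to the edge that starts at the image of \<open>act s x\<close>. As this depends on the cycle only, it is a
bijection of the edges.
\<close>

lemma schreier_iso: "schreier v \<simeq> schreier w"
proof -
  define g where "g = (\<lambda>(x, s). (if flip (cycle_root x s) then ray_map (act s x) else ray_map x, s))"
  have inj: "x = x'" if "x \<in> V" "x' \<in> V" "g (x, s) = g (x', s)" for x x' s
  proof -
    have inj_ray_map: "ray_map y = ray_map y' \<longleftrightarrow> y = y'" if "y \<in> V" "y' \<in> V" for y y'
      using bij_ray_map that by (auto simp: bij_betw_def inj_on_def)
    note aV = orbit_act(1)[OF that(1), of s] orbit_act(1)[OF that(2), of s]
    consider "flip (cycle_root x s) \<longleftrightarrow> flip (cycle_root x' s)" |
      "flip (cycle_root x s)" "\<not> flip (cycle_root x' s)" |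
      "\<not> flip (cycle_root x s)" "flip (cycle_root x' s)" by blast
    then show ?thesis
    proof cases
      case 1
      then have "act s x = act s x' \<or> x = x'"
        using that inj_ray_map aV by (auto simp: g_def split: if_splits)
      then show ?thesis by (metis act_inv_act)
    next
      case 2
      then have "act s x = x'" using that inj_ray_map aV by (auto simp: g_def)
      then show ?thesis using 2 ray_map_act(1)[OF that(1), of s] by simp
    next
      case 3
      then have "act s x' = x" using that inj_ray_map aV by (auto simp: g_def)
      then show ?thesis using 3 ray_map_act(1)[OF that(2), of s] by simp
    qed
  qed
  have "bij_betw g (V \<times> UNIV) (W \<times> UNIV)"
  proof (rule bij_betwI')
    fix p q assume "p \<in> V \<times> (UNIV :: gen set)" "q \<in> V \<times> (UNIV :: gen set)"
    moreover have "snd (g p) = snd p" for p by (simp add: g_def split: prod.split)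
    ultimately show "g p = g q \<longleftrightarrow> p = q"
      using inj by (metis (no_types, lifting) SigmaE snd_conv)
  next
    fix p assume "p \<in> V \<times> (UNIV :: gen set)"
    then show "g p \<in> W \<times> UNIV"
      by (auto simp: g_def ray_map_W_lead orbit_act(1))
  next
    fix q assume "q \<in> W \<times> (UNIV :: gen set)"
    then obtain y s where "y \<in> W" "q = (y, s)" by blast
    moreover from \<open>y \<in> W\<close> have "y \<in> ray_map ` V" using bij_betw_imp_surj_on[OF bij_ray_map] by simp
    ultimately obtain x where x: "x \<in> V" "q = (ray_map x, s)" by blast
    show "\<exists>p\<in>V \<times> UNIV. q = g p"
    proof (cases "flip (cycle_root x s)")
      case False
      then show ?thesis using x by (intro bexI[of _ "(x, s)"]) (auto simp: g_def)
    next
      case True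
      let ?y = "act_inv s x"
      have y: "?y \<in> V" using orbit_act x by blast
      have "flip (cycle_root ?y s)" using ray_map_act(1)[OF y, of s] True by simp
      then show ?thesis using x y by (intro bexI[of _ "(?y, s)"]) (auto simp: g_def)
    qed
  qed
  moreover have "(\<lambda>(x, s). {x, act s x}) (g (x, s)) = ray_map ` {x, act s x}" if "x \<in> V" for x s
    using ray_map_act(2,3)[OF that, of s] by (auto simp: g_def)
  ultimately show ?thesis
    unfolding multigraph_iso_def schreier_def using bij_ray_map
    by (intro exI[of _ ray_map] exI[of _ g]) auto
qed

end

lemma iso_if_matching:
  assumes "\<xi> \<in> E1" "\<eta> \<in> E1" "matching ((parent ^^ i) \<xi>) ((parent ^^ j) \<eta>)"
  shows "schreier \<xi> \<simeq> schreier \<eta>"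
proof -
  have "matching_rays ((parent ^^ i) \<xi>) ((parent ^^ j) \<eta>)"
    using assms by unfold_locales auto
  then have "schreier ((parent ^^ i) \<xi>) \<simeq> schreier ((parent ^^ j) \<eta>)"
    by (rule matching_rays.schreier_iso)
  moreover have "schreier ((parent ^^ k) u) = schreier u" if "u \<in> E1" for k u
  proof -
    have "confluent ((parent ^^ k) u) u"
      unfolding confluent_def by (metis funpow_0)
    then show ?thesis
      using orbit_eq[of "(parent ^^ k) u" u] that by (simp add: schreier_def)
  qed
  ultimately show ?thesis using assms by simp
qed

theorem schreier_iso_iff_matching:
  assumes "\<xi> \<in> E1" "\<eta> \<in> E1"
  shows "schreier \<xi> \<simeq> schreier \<eta> \<longleftrightarrow> (\<exists>i j. matching ((parent ^^ i) \<xi>) ((parent ^^ j) \<eta>))"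
  using assms matching_if_iso iso_if_matching by blast

section \<open>Reading the tree off the letters\<close>

text \<open>
The letters between the first \<open>1\<close> of \<open>u\<close> and the \<open>1\<close> that becomes the first one of its parent, without
the zeros that alternate with them.
\<close>

definition block :: "bit stream \<Rightarrow> bit list" where
  "block u = (THE xs. \<exists>n z. u = replicate n 0 @- 1 ## dilute xs @- 1 ## z)"

definition alike :: "bit list \<Rightarrow> bit list \<Rightarrow> bool" where
  "alike xs ys \<longleftrightarrow> ys = xs \<or> ys = map (\<lambda>x. 1 - x) xs"

lemma alike_sym: "alike xs ys \<Longrightarrow> alike ys xs"
proof -
  have "1 - (1 - x) = x" for x :: bit by (cases x) simp_all
  then have "map (\<lambda>x. 1 - x) (map (\<lambda>x. 1 - x) xs) = xs"
    unfolding map_map o_def by (intro map_idI)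
  then show "alike xs ys \<Longrightarrow> alike ys xs" unfolding alike_def by metis
qed

lemma alike_refl [simp]: "alike xs xs"
  by (simp add: alike_def)

lemma length_alike: "alike xs ys \<Longrightarrow> length xs = length ys"
  by (auto simp: alike_def)

lemma parent_dilute:
  "parent (replicate n 0 @- 1 ## dilute xs @- 1 ## z) = replicate (Suc (n + 2 * length xs)) 0 @- 1 ## z"
  "offset (replicate n 0 @- 1 ## dilute xs @- 1 ## z) = 2 ^ (n div 2) * (1 + 2 * binval xs)"
  using parent_cycle_word[OF _ offset_dilute_less] unfolding cycle_word_dilute cycle_word_root by simp_all

lemma block_dilute [simp]: "block (replicate n 0 @- 1 ## dilute xs @- 1 ## z) = xs"
  unfolding block_def
proof (rule the_equality)
  fix ys assume "\<exists>n' z'. replicate n 0 @- 1 ## dilute xs @- 1 ## z = replicate n' 0 @- 1 ## dilute ys @- 1 ## z'"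
  then obtain n' z' where e: "replicate n 0 @- 1 ## dilute xs @- 1 ## z = replicate n' 0 @- 1 ## dilute ys @- 1 ## z'"
    by blast
  from arg_cong[OF e, of lead] have n: "n = n'" by simp
  from arg_cong[OF e, of "\<lambda>u. lead (parent u)"] have "length xs = length ys"
    unfolding parent_dilute lead_replicate n by simp
  moreover from arg_cong[OF e, of offset] have "binval xs = binval ys"
    unfolding parent_dilute n by simp
  ultimately show "ys = xs" using binval_inj by metis
qed blast

lemma E1_obtain_block:
  assumes "u \<in> E1"
  obtains z where "u = replicate (lead u) 0 @- 1 ## dilute (block u) @- 1 ## z"
proof -
  obtain n w where u: "u = replicate n 0 @- 1 ## w"
    using E1_obtain_lead assms by blast
  with assms have "w \<in> E1" by simp
  then obtain xs z where "w = dilute xs @- 1 ## z"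
    using E1_obtain_dilute by blast
  with that[of z] show thesis by (simp add: u)
qed

lemma lead_parent_block:
  assumes "u \<in> E1"
  shows "lead (parent u) = Suc (lead u + 2 * length (block u))"
proof -
  obtain z where z: "u = replicate (lead u) 0 @- 1 ## dilute (block u) @- 1 ## z"
    using E1_obtain_block assms by blast
  have "parent u = replicate (Suc (lead u + 2 * length (block u))) 0 @- 1 ## z"
    by (subst z) (rule parent_dilute)
  then show ?thesis by (simp only: lead_replicate)
qed

lemma offset_block: "u \<in> E1 \<Longrightarrow> offset u = 2 ^ (lead u div 2) * (1 + 2 * binval (block u))"
  by (metis E1_obtain_block parent_dilute(2))

text \<open>
Passing to the parent only changes letters before its first \<open>1\<close>.
\<close>

lemma sdrop_parent:
  assumes "u \<in> E1"
  shows "sdrop (lead (parent u)) u = sdrop (lead (parent u)) (parent u)"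
    and "u !! lead (parent u) = 1"
proof -
  obtain z where z: "u = replicate (lead u) 0 @- 1 ## dilute (block u) @- 1 ## z"
    using E1_obtain_block assms by blast
  then have u: "u = (replicate (lead u) 0 @ 1 # dilute (block u)) @- 1 ## z" by simp
  have p: "parent u = replicate (lead (parent u)) 0 @- 1 ## z"
    unfolding lead_parent_block[OF assms] by (subst z) (rule parent_dilute)
  have l: "lead (parent u) = length (replicate (lead u) 0 @ 1 # dilute (block u))"
    by (simp add: lead_parent_block assms)
  have s: "sdrop (lead (parent u)) u = 1 ## z"
    unfolding l by (subst (2) u) (simp only: sdrop_shift, simp)
  moreover have "sdrop (lead (parent u)) (parent u) = 1 ## z"
    by (subst (2) p) (simp add: sdrop_shift)
  ultimately show "sdrop (lead (parent u)) u = sdrop (lead (parent u)) (parent u)" by simp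
  show "u !! lead (parent u) = 1"
    using s sdrop_snth[of "lead (parent u)" u 0] by simp
qed

lemma sdrop_parent_pow:
  assumes "u \<in> E1"
  shows "sdrop (lead ((parent ^^ i) u)) u = sdrop (lead ((parent ^^ i) u)) ((parent ^^ i) u)"
proof (induction i)
  case (Suc i)
  let ?v = "(parent ^^ i) u"
  have "lead ?v \<le> lead (parent ?v)" using lead_parent[of ?v] assms by simp
  then obtain c where c: "lead (parent ?v) = lead ?v + c" using le_Suc_ex by blast
  have "sdrop (lead (parent ?v)) u = sdrop (lead (parent ?v)) ?v"
    unfolding c sdrop_add[symmetric] using Suc by simp
  with sdrop_parent(1)[of ?v] assms show ?case by simp
qed simp

text \<open>
The offset is \<open>2\<^sup>q(1 + 2\<beta>)\<close>, where \<open>\<beta>\<close> is the value of the block, and the size of the cycle is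
\<open>2\<^sup>q2\<^sup>p\<^sup>+\<^sup>1\<close>, where \<open>p\<close> is the length of the block. So two offsets add up to the size if and only if
the values of the blocks add up to \<open>2\<^sup>p - 1\<close>, that is, the blocks are complementary.
\<close>

lemma offset_iff_alike:
  assumes "u \<in> E1" "v \<in> E1" "lead u = lead v" "length (block u) = length (block v)"
  shows "offset v = offset u \<or> offset v = cycle_size (lead (parent u)) - offset u \<longleftrightarrow> alike (block u) (block v)"
proof -
  let ?xs = "block u" and ?ys = "block v" and ?p = "2 ^ (lead u div 2) :: nat"
  let ?n = "length ?xs"
  have o: "offset u = ?p * (1 + 2 * binval ?xs)" "offset v = ?p * (1 + 2 * binval ?ys)"
    using offset_block assms by auto
  have N: "cycle_size (lead (parent u)) = ?p * (2 * 2 ^ ?n)"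
    by (simp add: lead_parent_block assms cycle_size_def power_add)
  have "offset v = offset u \<longleftrightarrow> ?ys = ?xs"
    unfolding o using binval_inj assms(4) by auto
  moreover have "offset v = cycle_size (lead (parent u)) - offset u \<longleftrightarrow> ?ys = map (\<lambda>x. 1 - x) ?xs"
  proof -
    have "offset v = cycle_size (lead (parent u)) - offset u \<longleftrightarrow>
        1 + 2 * binval ?ys = 2 * 2 ^ ?n - (1 + 2 * binval ?xs)"
      unfolding o N diff_mult_distrib2[symmetric] by (simp only: mult_cancel1) simp
    also have "\<dots> \<longleftrightarrow> binval ?ys + binval ?xs + 1 = 2 ^ ?n"
      using binval_less[of ?xs] by linarith
    also have "\<dots> \<longleftrightarrow> binval ?ys = binval (map (\<lambda>x. 1 - x) ?xs)"
      using binval_compl[of ?xs] by linarith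
    also have "\<dots> \<longleftrightarrow> ?ys = map (\<lambda>x. 1 - x) ?xs"
      using binval_inj[of ?ys "map (\<lambda>x. 1 - x) ?xs"] assms(4) by auto
    finally show ?thesis .
  qed
  ultimately show ?thesis by (simp add: alike_def)
qed

text \<open>
The increase of the lead from a vertex to its parent determines the length of the block and
conversely, so equality of leads along the ray follows from equality at the start.
\<close>

lemma matching_iff_blocks:
  assumes "u \<in> E1" "v \<in> E1"
  shows "matching u v \<longleftrightarrow>
    lead u = lead v \<and> (\<forall>l. alike (block ((parent ^^ l) u)) (block ((parent ^^ l) v)))"
proof
  assume m: "matching u v"
  have "alike (block ((parent ^^ l) u)) (block ((parent ^^ l) v))" for l
  proof -
    let ?u = "(parent ^^ l) u" and ?v = "(parent ^^ l) v"
    have E: "?u \<in> E1" "?v \<in> E1" using assms by auto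
    have l: "lead ?u = lead ?v" using m by (simp add: matching_def)
    moreover have "lead (parent ?u) = lead (parent ?v)"
      using m unfolding matching_def by (metis comp_apply funpow.simps(2))
    ultimately have "length (block ?u) = length (block ?v)"
      using lead_parent_block E by simp
    from offset_iff_alike[OF E l this] m show ?thesis
      by (simp add: matching_def)
  qed
  moreover have "lead u = lead v"
    using m unfolding matching_def by (metis funpow_0)
  ultimately show "lead u = lead v \<and> (\<forall>l. alike (block ((parent ^^ l) u)) (block ((parent ^^ l) v)))"
    by blast
next
  assume a: "lead u = lead v \<and> (\<forall>l. alike (block ((parent ^^ l) u)) (block ((parent ^^ l) v)))"
  have l: "lead ((parent ^^ l) u) = lead ((parent ^^ l) v)" for l
  proof (induction l)
    case (Suc l)
    then show ?case
      using lead_parent_block[of "(parent ^^ l) u"] lead_parent_block[of "(parent ^^ l) v"] assms a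
        length_alike by simp
  qed (use a in simp)
  have "offset ((parent ^^ l) v) = offset ((parent ^^ l) u) \<or>
      offset ((parent ^^ l) v) = cycle_size (lead ((parent ^^ Suc l) u)) - offset ((parent ^^ l) u)" for l
    using offset_iff_alike[of "(parent ^^ l) u" "(parent ^^ l) v"] assms l a length_alike by auto
  with l show "matching u v" unfolding matching_def by blast
qed

lemma parent_ones: "parent (replicate n 0 @- 1 ## 1 ## z) = replicate (Suc n) 0 @- 1 ## z"
  and block_ones [simp]: "block (replicate n 0 @- 1 ## 1 ## z) = []"
  using parent_dilute(1)[of n "[]" z] block_dilute[of n "[]" z] by simp_all

lemma parent_pow_sconst:
  "(parent ^^ l) (replicate n 0 @- sconst 1) = replicate (n + l) 0 @- sconst 1"
proof (induction l)
  case (Suc l)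
  then show ?case
    using parent_ones[of "n + l" "sconst 1"]
    by (metis add_Suc_right comp_apply funpow.simps(2) siterate.ctr id_apply)
qed simp

lemma eventually_ones:
  assumes "u @- sconst 1 \<in> E1"
  obtains i n where "(parent ^^ i) (u @- sconst 1) = replicate n 0 @- sconst 1"
proof -
  let ?x = "u @- sconst 1"
  \<comment> \<open>After \<open>length u\<close> steps the lead is at least the length of \<open>u\<close>, so that only ones follow.\<close>
  let ?i = "length u"
  let ?v = "(parent ^^ ?i) ?x"
  have "?i \<le> lead ?v" using lead_parent_pow[OF assms, of ?i] by simp
  then have "sdrop (lead ?v) ?x = sconst 1"
    by (simp add: sdrop_shift sdrop_siterate)
  then have "sdrop (lead ?v) ?v = sconst 1"
    using sdrop_parent_pow[OF assms] by simp
  moreover have "?v = replicate (lead ?v) 0 @- sdrop (lead ?v) ?v"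
  proof -
    have "?v \<in> E1" using assms parent_pow_E1 by blast
    then obtain z where "?v = replicate (lead ?v) 0 @- 1 ## z"
      using E1_obtain_block by metis
    then show ?thesis using sdrop_shift[of "lead ?v" "replicate (lead ?v) 0" "1 ## z"] by simp
  qed
  ultimately show thesis using that by metis
qed

text \<open>
With empty blocks the lead increases by one at each step, so that every position from some point on
is the first \<open>1\<close> of an ancestor, and thus contains a \<open>1\<close> in \<open>u\<close> itself.
\<close>

lemma ones_if_blocks_empty:
  assumes "u \<in> E1" "\<And>l. i \<le> l \<Longrightarrow> block ((parent ^^ l) u) = []"
  shows "\<exists>w. u = w @- sconst 1"
proof -
  define v where "v = (parent ^^ i) u"
  have v: "v \<in> E1" "\<And>l. block ((parent ^^ l) v) = []"
    using assms by (auto simp: v_def funpow_funpow)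
  have l: "lead ((parent ^^ l) v) = lead v + l" for l
    by (induction l) (simp_all add: lead_parent_block v)
  have "sdrop (lead v) v !! l = 1" for l
  proof -
    have "sdrop (lead v + l) v = sdrop (lead v + l) ((parent ^^ l) v)"
      using sdrop_parent_pow[OF v(1), of l] by (simp add: l)
    then have "v !! (lead v + l) = (parent ^^ l) v !! (lead v + l)"
      using sdrop_snth[of _ _ 0] by (metis add_0_right)
    also have "\<dots> = 1"
    proof -
      obtain z where "(parent ^^ l) v = replicate (lead v + l) 0 @- 1 ## z"
        using E1_obtain_block[OF parent_pow_E1[OF v(1)], of l] unfolding l by blast
      then show ?thesis by simp
    qed
    finally show ?thesis by (simp add: sdrop_snth)
  qed
  then have "sdrop (lead v) v = sconst 1"
    unfolding sconst_alt sset_range by auto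
  then have "sdrop (lead v) u = sconst 1"
    using sdrop_parent_pow[OF assms(1), of i] by (simp add: v_def)
  then show ?thesis by (metis stake_sdrop)
qed

section \<open>Canonical representations\<close>

lemma concat_dilute: "concat (map (\<lambda>i. [0, x i]) is) = dilute (map x is)"
  by (induction "is") auto

text \<open>
In a run of ones each step to the parent turns one of them into \<open>0\<close>.
\<close>

lemma parent_pow_ones:
  "(parent ^^ i) (replicate n 0 @- replicate (Suc i) 1 @- z) = replicate (n + i) 0 @- 1 ## z"
proof (induction i arbitrary: n)
  case (Suc i)
  have "parent (replicate n 0 @- replicate (Suc (Suc i)) 1 @- z) =
      replicate (Suc n) 0 @- replicate (Suc i) 1 @- z"
    using parent_ones[of n "replicate i 1 @- z"] by simp
  then show ?case using Suc[of "Suc n"] by (simp add: funpow_swap1 del: replicate.simps)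
qed simp

lemma block_parent_pow_ones:
  assumes "i < c"
  shows "block ((parent ^^ i) (replicate n 0 @- replicate (Suc c) 1 @- z)) = []"
proof -
  have "replicate (Suc c) 1 @- z = replicate (Suc i) 1 @- 1 ## replicate (c - Suc i) 1 @- z"
    (is "?l = _")
  proof -
    have "Suc c = Suc i + Suc (c - Suc i)" using assms by simp
    then show ?thesis by (metis replicate_Suc replicate_add shift.simps(2) shift_append)
  qed
  then show ?thesis by (simp only: parent_pow_ones block_ones)
qed

text \<open>
With \<open>T j\<close> the sum of \<open>t 0, \<dots>, t j\<close>, the ancestor number \<open>T j\<close> of \<open>\<xi>\<close> is \<open>0\<^sup>n1\<close> followed by the part of the
canonical representation that begins with the \<open>j\<close>-th group. Its block consists of the \<open>x j i\<close>, and the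
blocks of the ancestors up to the next such one are empty.
\<close>

locale canonical =
  fixes \<xi> :: "bit stream" and k :: nat and m t :: "nat \<Rightarrow> nat" and x :: "nat \<Rightarrow> nat \<Rightarrow> bit"
  assumes rep: "canonical_rep \<xi> k m t x" and E1: "\<xi> \<in> E1"
begin

definition X :: "nat \<Rightarrow> bit list" where
  "X j = map (x j) [1..<m j div 2 + 1]"

definition rest :: "nat \<Rightarrow> bit stream" where
  "rest j = flat (smap (\<lambda>j. dilute (X j) @ replicate (t (j + 1)) 1) (fromN j))"

definition T :: "nat \<Rightarrow> nat" where
  "T j = (\<Sum>l=0..j. t l)"

text \<open>
The lead of the ancestor number \<open>T j\<close>.
\<close>

definition start :: "nat \<Rightarrow> nat" where
  "start j = k - 1 + T j + (\<Sum>l<j. m l)"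

lemma t0: "t 0 = 0" and t_pos: "0 < t (Suc j)" and k_pos: "1 \<le> k"
  and m_even: "even (m j)" and m_pos: "0 < j \<Longrightarrow> 0 < m j"
  using rep unfolding canonical_rep_def by (auto simp: Suc_le_eq) (cases j; auto)

lemma length_X: "2 * length (X j) = m j"
  using m_even[of j] by (simp add: X_def del: upt_Suc)

lemma rest_unfold: "rest j = dilute (X j) @- replicate (t (Suc j)) 1 @- rest (Suc j)"
proof -
  have ne: "dilute (X j) @ replicate (t (j + 1)) 1 \<noteq> []"
    using t_pos[of j] by simp
  have "smap (\<lambda>j. dilute (X j) @ replicate (t (j + 1)) 1) (fromN j) =
     (dilute (X j) @ replicate (t (j + 1)) 1) ## smap (\<lambda>j. dilute (X j) @ replicate (t (j + 1)) 1) (fromN (Suc j))"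
    by (subst siterate.ctr) (simp add: stream.expand)
  then show ?thesis
    unfolding rest_def using flat_Cons flat_Stream[OF ne] by simp
qed

lemma rep_start: "\<xi> = replicate (k - 1) 0 @- 1 ## rest 0"
proof -
  have "\<xi> = (replicate (k - 1) 0 @ [1]) @-
         flat (smap (\<lambda>j. concat (map (\<lambda>i. [0, x j i]) [1..<m j div 2 + 1])
                          @ replicate (t (j + 1)) 1) nats)"
    using rep unfolding canonical_rep_def by blast
  then show ?thesis by (simp only: rest_def X_def concat_dilute shift_append shift.simps)
qed

lemma step:
  assumes "\<zeta> = replicate n 0 @- 1 ## rest j"
  shows "(parent ^^ t (Suc j)) \<zeta> = replicate (n + m j + t (Suc j)) 0 @- 1 ## rest (Suc j)"
    and "\<lbrakk>0 < i; i < t (Suc j)\<rbrakk> \<Longrightarrow> block ((parent ^^ i) \<zeta>) = []"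
    and "block \<zeta> = X j"
proof -
  obtain c where c: "t (Suc j) = Suc c" using t_pos[of j] gr0_implies_Suc by blast
  have z: "\<zeta> = replicate n 0 @- 1 ## dilute (X j) @- 1 ## replicate c 1 @- rest (Suc j)"
    using assms rest_unfold[of j] by (simp add: c)
  show "block \<zeta> = X j" unfolding z by simp
  have p: "parent \<zeta> = replicate (Suc (n + m j)) 0 @- replicate (Suc c) 1 @- rest (Suc j)"
    unfolding z parent_dilute length_X by simp
  have "(parent ^^ t (Suc j)) \<zeta> = (parent ^^ c) (parent \<zeta>)"
    by (simp add: c funpow_swap1)
  also have "\<dots> = replicate (Suc (n + m j) + c) 0 @- 1 ## rest (Suc j)"
    unfolding p by (rule parent_pow_ones)
  finally show "(parent ^^ t (Suc j)) \<zeta> = replicate (n + m j + t (Suc j)) 0 @- 1 ## rest (Suc j)"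
    by (simp add: c)
  assume i: "0 < i" "i < t (Suc j)"
  then obtain i' where i': "i = Suc i'" using gr0_implies_Suc by blast
  have "(parent ^^ i) \<zeta> = (parent ^^ i') (parent \<zeta>)"
    by (simp add: i' funpow_swap1)
  then show "block ((parent ^^ i) \<zeta>) = []"
    unfolding p using block_parent_pow_ones[of i' c] i c i' by (simp only: Suc_less_eq)
qed

lemma T_0 [simp]: "T 0 = 0"
  by (simp add: T_def t0)

lemma T_Suc: "T (Suc j) = T j + t (Suc j)"
  by (simp add: T_def)

lemma strict_mono_T: "strict_mono T"
  by (simp add: strict_mono_Suc_iff T_Suc t_pos)

lemma parent_pow_T: "(parent ^^ T j) \<xi> = replicate (start j) 0 @- 1 ## rest j"
proof (induction j)
  case 0
  show ?case using rep_start by (simp add: start_def)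
next
  case (Suc j)
  have "(parent ^^ T (Suc j)) \<xi> = (parent ^^ t (Suc j)) ((parent ^^ T j) \<xi>)"
    unfolding T_Suc by (subst add.commute) (simp add: funpow_add)
  also have "\<dots> = replicate (start j + m j + t (Suc j)) 0 @- 1 ## rest (Suc j)"
    by (rule step(1)[OF Suc])
  also have "start j + m j + t (Suc j) = start (Suc j)"
    by (simp add: start_def T_Suc)
  finally show ?case .
qed

lemma lead_T: "lead ((parent ^^ T j) \<xi>) = start j"
  by (simp add: parent_pow_T)

lemma block_T: "block ((parent ^^ T j) \<xi>) = X j"
  using step(3)[OF parent_pow_T] .

lemma block_not_T:
  assumes "p \<notin> range T"
  shows "block ((parent ^^ p) \<xi>) = []"
proof -
  have "\<exists>j. p < T j" using strict_mono_imp_increasing[OF strict_mono_T] by (metis Suc_le_eq lessI order_less_le_trans)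
  then have "p < T (LEAST j. p < T j)" by (metis LeastI)
  moreover from this obtain j where j: "(LEAST j. p < T j) = Suc j"
    by (cases "LEAST j. p < T j") auto
  ultimately have "p < T (Suc j)" "\<not> p < T j"
    using not_less_Least[of j "\<lambda>j. p < T j"] by auto
  with assms have "T j < p" by (metis linorder_neqE_nat rangeI)
  then have "(parent ^^ p) \<xi> = (parent ^^ (p - T j)) ((parent ^^ T j) \<xi>)"
    by (metis comp_apply funpow_add le_add_diff_inverse2 less_imp_le)
  then show ?thesis
    using step(2)[OF parent_pow_T, of "p - T j" j] \<open>T j < p\<close> \<open>p < T (Suc j)\<close> by (simp add: T_Suc)
qed

lemma X_nonempty: "0 < j \<Longrightarrow> X j \<noteq> []"
  using length_X[of j] m_pos[of j] by auto

text \<open>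
The ancestor number \<open>0\<close> is special as \<open>m 0\<close> may vanish.
\<close>

lemma block_nonempty_iff: "0 < p \<Longrightarrow> block ((parent ^^ p) \<xi>) \<noteq> [] \<longleftrightarrow> (\<exists>j>0. p = T j)"
  using block_not_T block_T X_nonempty T_0 by (metis gr0I less_irrefl rangeE)

text \<open>
The exponents can be recovered as gaps up to the next nonempty block, so they are the same for
matching rays.
\<close>

lemma t_Suc_Least: "t (Suc j) = (LEAST l. 0 < l \<and> block ((parent ^^ (T j + l)) \<xi>) \<noteq> [])"
proof (rule Least_equality[symmetric])
  show "0 < t (Suc j) \<and> block ((parent ^^ (T j + t (Suc j))) \<xi>) \<noteq> []"
    using t_pos block_T[of "Suc j"] X_nonempty by (simp add: T_Suc)
next
  fix l assume l: "0 < l \<and> block ((parent ^^ (T j + l)) \<xi>) \<noteq> []"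
  then obtain i where i: "T j + l = T i" using block_nonempty_iff[of "T j + l"] by auto
  then have "T j < T i" using l by linarith
  then have "j < i" using strict_mono_less[OF strict_mono_T] by blast
  then have "T (Suc j) \<le> T i" using strict_mono_less_eq[OF strict_mono_T] by simp
  then show "t (Suc j) \<le> l" using i by (simp add: T_Suc)
qed

end

locale two_canonical =
  A: canonical \<xi> k m t x + B: canonical \<eta> k' m' t' y
  for \<xi> k m t x \<eta> k' m' t' y
begin

text \<open>
Apart from the groups all blocks are empty, so two rays that begin at groups match precisely if the
gaps between groups are equal and the groups agree up to complement. The equation of leads at the
start is the remaining condition.
\<close>

lemma matching_T_iff:
  "matching ((parent ^^ A.T r) \<xi>) ((parent ^^ B.T s) \<eta>) \<longleftrightarrow>
     A.start r = B.start s \<and> (\<forall>n. t (r + n + 1) = t' (s + n + 1) \<and> alike (A.X (r + n)) (B.X (s + n)))"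
  if "0 < r" "0 < s"
proof -
  have m: "matching ((parent ^^ A.T r) \<xi>) ((parent ^^ B.T s) \<eta>) \<longleftrightarrow>
     A.start r = B.start s \<and> (\<forall>l. alike (block ((parent ^^ (A.T r + l)) \<xi>)) (block ((parent ^^ (B.T s + l)) \<eta>)))"
    (is "_ \<longleftrightarrow> _ \<and> (\<forall>l. ?al l)")
    by (subst matching_iff_blocks) (simp_all add: A.E1 B.E1 A.lead_T B.lead_T funpow_funpow)
  have "(\<forall>l. ?al l) \<longleftrightarrow> (\<forall>n. t (r + n + 1) = t' (s + n + 1) \<and> alike (A.X (r + n)) (B.X (s + n)))"
  proof
    assume al: "\<forall>l. ?al l"
    then have ne: "block ((parent ^^ (A.T r + l)) \<xi>) \<noteq> [] \<longleftrightarrow> block ((parent ^^ (B.T s + l)) \<eta>) \<noteq> []" for l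
      using length_alike by (metis length_0_conv)
    have *: "\<exists>c. A.T (r + n) = A.T r + c \<and> B.T (s + n) = B.T s + c \<and> t (Suc (r + n)) = t' (Suc (s + n))" for n
    proof (induction n)
      case 0
      show ?case
        unfolding A.t_Suc_Least B.t_Suc_Least using ne by simp
    next
      case (Suc n)
      then obtain c where c: "A.T (r + Suc n) = A.T r + c" "B.T (s + Suc n) = B.T s + c"
        by (auto simp: A.T_Suc B.T_Suc)
      moreover have "t (Suc (r + Suc n)) = t' (Suc (s + Suc n))"
        unfolding A.t_Suc_Least B.t_Suc_Least c using ne by (simp add: add.assoc)
      ultimately show ?case by blast
    qed
    show "\<forall>n. t (r + n + 1) = t' (s + n + 1) \<and> alike (A.X (r + n)) (B.X (s + n))"
    proof
      fix n
      obtain c where c: "A.T (r + n) = A.T r + c" "B.T (s + n) = B.T s + c" "t (Suc (r + n)) = t' (Suc (s + n))"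
        using * by blast
      then have "alike (A.X (r + n)) (B.X (s + n))"
        using al A.block_T[of "r + n"] B.block_T[of "s + n"] by metis
      with c show "t (r + n + 1) = t' (s + n + 1) \<and> alike (A.X (r + n)) (B.X (s + n))" by simp
    qed
  next
    assume h: "\<forall>n. t (r + n + 1) = t' (s + n + 1) \<and> alike (A.X (r + n)) (B.X (s + n))"
    have *: "\<exists>c. A.T (r + n) = A.T r + c \<and> B.T (s + n) = B.T s + c" for n
    proof (induction n)
      case (Suc n)
      then show ?case using h by (auto simp: A.T_Suc B.T_Suc)
    qed simp
    show "\<forall>l. ?al l"
    proof
      fix l
      show "?al l"
      proof (cases "\<exists>n. A.T (r + n) = A.T r + l")
        case True
        then obtain n where "A.T (r + n) = A.T r + l" "B.T (s + n) = B.T s + l"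
          using * by (metis add_left_cancel)
        then show ?thesis using h A.block_T[of "r + n"] B.block_T[of "s + n"] by metis
      next
        case False
        then have F: "\<not> (\<exists>n. B.T (s + n) = B.T s + l)" using * by (metis add_left_cancel)
        have "A.T r + l \<notin> range A.T"
        proof
          assume "A.T r + l \<in> range A.T"
          then obtain j where "A.T j = A.T r + l" by (metis imageE)
          moreover from this have "r \<le> j" using strict_mono_less_eq[OF A.strict_mono_T, of r j] by simp
          ultimately show False using False by (metis le_add_diff_inverse)
        qed
        moreover have "B.T s + l \<notin> range B.T"
        proof
          assume "B.T s + l \<in> range B.T"
          then obtain j where "B.T j = B.T s + l" by (metis imageE)
          moreover from this have "s \<le> j" using strict_mono_less_eq[OF B.strict_mono_T, of s j] by simp
          ultimately show False using F by (metis le_add_diff_inverse)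
        qed
        ultimately show ?thesis using A.block_not_T B.block_not_T by simp
      qed
    qed
  qed
  with m show ?thesis by blast
qed

text \<open>
A match of two tails can be shortened until both start at a group with positive number, which is a
nonempty block on either side.
\<close>

lemma matching_at_blocks:
  assumes "matching ((parent ^^ i) \<xi>) ((parent ^^ j) \<eta>)"
  shows "\<exists>r\<ge>1. \<exists>s\<ge>1. matching ((parent ^^ A.T r) \<xi>) ((parent ^^ B.T s) \<eta>)"
proof -
  \<comment> \<open>Since \<open>T\<close> increases strictly, this group begins beyond the ancestor number \<open>i\<close>.\<close>
  define r where "r = Suc i"
  have "r \<le> A.T r" using strict_mono_imp_increasing[OF A.strict_mono_T] .
  then obtain l where l: "A.T r = i + l" "0 < l"
    by (metis Suc_le_eq less_imp_add_positive r_def)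
  have "alike (block ((parent ^^ (i + l)) \<xi>)) (block ((parent ^^ (j + l)) \<eta>))"
    using assms matching_iff_blocks[of "(parent ^^ i) \<xi>" "(parent ^^ j) \<eta>"] A.E1 B.E1 by (simp add: funpow_funpow)
  moreover have "block ((parent ^^ (i + l)) \<xi>) \<noteq> []"
    using A.block_T[of r] A.X_nonempty[of r] l(1) r_def by (metis zero_less_Suc)
  ultimately have "block ((parent ^^ (j + l)) \<eta>) \<noteq> []"
    using length_alike by fastforce
  then obtain s where s: "0 < s" "j + l = B.T s"
    using B.block_nonempty_iff[of "j + l"] l(2) by auto
  have "matching ((parent ^^ (i + l)) \<xi>) ((parent ^^ (j + l)) \<eta>)"
    using matching_parent_pow[OF assms, of l] by (simp only: funpow_funpow)
  then show ?thesis
    using s l(1) by (intro exI[of _ r] exI[of _ s] conjI) (auto simp: r_def)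
qed

lemma start_eq_iff:
  assumes "1 \<le> r" "1 \<le> s"
  shows "A.start r = B.start s \<longleftrightarrow>
    k + (\<Sum>l=0..r. t l) + (\<Sum>l=0..r - 1. m l) = k' + (\<Sum>l=0..s. t' l) + (\<Sum>l=0..s - 1. m' l)"
proof -
  have "{0..n - 1} = {..<n}" if "1 \<le> n" for n :: nat using that by auto
  then show ?thesis
    using A.k_pos B.k_pos assms by (simp add: A.start_def B.start_def A.T_def B.T_def) linarith
qed

lemma alike_X_iff:
  "alike (A.X i) (B.X j) \<longleftrightarrow> m i = m' j \<and>
     ((\<forall>p\<in>{1..m i div 2}. y j p = x i p) \<or> (\<forall>p\<in>{1..m i div 2}. y j p = 1 - x i p))"
proof (cases "m i = m' j")
  case True
  then show ?thesis
    by (auto simp: alike_def A.X_def B.X_def map_eq_conv simp del: upt_Suc)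
next
  case False
  then show ?thesis using length_alike A.length_X[of i] B.length_X[of j] by fastforce
qed

lemma schreier_iso_iff:
  "schreier \<xi> \<simeq> schreier \<eta> \<longleftrightarrow>
     (\<exists>r\<ge>1. \<exists>s\<ge>1. \<forall>n.
        m (r + n) = m' (s + n) \<and> t (r + n + 1) = t' (s + n + 1) \<and>
        k + (\<Sum>l=0..r. t l) + (\<Sum>l=0..r - 1. m l) = k' + (\<Sum>l=0..s. t' l) + (\<Sum>l=0..s - 1. m' l) \<and>
        ((\<forall>p\<in>{1..m (r + n) div 2}. y (s + n) p = x (r + n) p) \<or>
         (\<forall>p\<in>{1..m (r + n) div 2}. y (s + n) p = 1 - x (r + n) p)))"
proof -
  have "schreier \<xi> \<simeq> schreier \<eta> \<longleftrightarrow> (\<exists>r\<ge>1. \<exists>s\<ge>1. matching ((parent ^^ A.T r) \<xi>) ((parent ^^ B.T s) \<eta>))"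
    using schreier_iso_iff_matching[OF A.E1 B.E1] matching_at_blocks by blast
  also have "\<dots> \<longleftrightarrow> (\<exists>r\<ge>1. \<exists>s\<ge>1. \<forall>n.
        m (r + n) = m' (s + n) \<and> t (r + n + 1) = t' (s + n + 1) \<and>
        k + (\<Sum>l=0..r. t l) + (\<Sum>l=0..r - 1. m l) = k' + (\<Sum>l=0..s. t' l) + (\<Sum>l=0..s - 1. m' l) \<and>
        ((\<forall>p\<in>{1..m (r + n) div 2}. y (s + n) p = x (r + n) p) \<or>
         (\<forall>p\<in>{1..m (r + n) div 2}. y (s + n) p = 1 - x (r + n) p)))"
    (is "_ \<longleftrightarrow> (\<exists>r\<ge>1. \<exists>s\<ge>1. ?P r s)")
  proof -
    have "matching ((parent ^^ A.T r) \<xi>) ((parent ^^ B.T s) \<eta>) \<longleftrightarrow> ?P r s" if "1 \<le> r" "1 \<le> s" for r s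
      using that unfolding start_eq_iff[OF that, symmetric]
      by (subst matching_T_iff) (auto simp: alike_X_iff)
    then show ?thesis by blast
  qed
  finally show ?thesis .
qed

end

lemma matching_sym: "\<lbrakk>u \<in> E1; v \<in> E1\<rbrakk> \<Longrightarrow> matching u v \<longleftrightarrow> matching v u"
  using matching_iff_blocks alike_sym by metis

lemma schreier_iso_sym:
  "\<lbrakk>\<xi> \<in> E1; \<eta> \<in> E1\<rbrakk> \<Longrightarrow> schreier \<xi> \<simeq> schreier \<eta> \<longleftrightarrow> schreier \<eta> \<simeq> schreier \<xi>"
  using schreier_iso_iff_matching matching_sym parent_pow_E1 by metis

text \<open>
Both rays run into the ray of the words \<open>0\<^sup>n1\<^sup>\<omega>\<close>, so the trees and hence the orbits are the same.
\<close>

lemma schreier_eq_ones: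
  assumes "u @- sconst 1 \<in> E1" "w @- sconst 1 \<in> E1"
  shows "schreier (u @- sconst 1) = schreier (w @- sconst 1)"
proof -
  obtain i n where i: "(parent ^^ i) (u @- sconst 1) = replicate n 0 @- sconst 1"
    using eventually_ones assms(1) by blast
  obtain j n' where j: "(parent ^^ j) (w @- sconst 1) = replicate n' 0 @- sconst 1"
    using eventually_ones assms(2) by blast
  have "(parent ^^ (n' + i)) (u @- sconst 1) = replicate (n + n') 0 @- sconst 1"
    by (simp only: funpow_add comp_apply i parent_pow_sconst)
  moreover have "(parent ^^ (n + j)) (w @- sconst 1) = replicate (n' + n) 0 @- sconst 1"
    by (simp only: funpow_add comp_apply j parent_pow_sconst)
  ultimately have "(parent ^^ (n' + i)) (u @- sconst 1) = (parent ^^ (n + j)) (w @- sconst 1)"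
    by (simp only: add.commute)
  then have "confluent (u @- sconst 1) (w @- sconst 1)" unfolding confluent_def by blast
  then show ?thesis using orbit_eq[OF assms] by (simp add: schreier_def)
qed

text \<open>
The blocks of matching rays have equal lengths, so eventual emptiness of the blocks is an invariant.
\<close>

lemma not_iso_ones:
  assumes "u @- sconst 1 \<in> E1" "\<eta> \<in> E1" "schreier (u @- sconst 1) \<simeq> schreier \<eta>"
  shows "\<exists>w. \<eta> = w @- sconst 1"
proof -
  define x where "x = u @- sconst 1"
  have x: "x \<in> E1" using assms(1) by (simp only: x_def)
  obtain i j where m: "matching ((parent ^^ i) x) ((parent ^^ j) \<eta>)"
    using matching_if_iso[OF assms] unfolding x_def by blast
  obtain i0 n where n: "(parent ^^ i0) x = replicate n 0 @- sconst 1"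
    using eventually_ones[OF assms(1)] unfolding x_def by blast
  have "block ((parent ^^ l) \<eta>) = []" if "j + i0 \<le> l" for l
  proof -
    define c where "c = l - j - i0"
    have c: "l = j + (i0 + c)" using that by (simp add: c_def)
    have "alike (block ((parent ^^ (i + (i0 + c))) x)) (block ((parent ^^ l) \<eta>))"
      using m matching_iff_blocks[OF parent_pow_E1[OF x] parent_pow_E1[OF assms(2)], of i j]
      unfolding c funpow_funpow by blast
    moreover have "(parent ^^ (i + (i0 + c))) x = (parent ^^ (c + i)) ((parent ^^ i0) x)"
      unfolding funpow_funpow by (simp only: ac_simps)
    then have "(parent ^^ (i + (i0 + c))) x = replicate (n + (c + i)) 0 @- 1 ## 1 ## sconst 1"
      unfolding n parent_pow_sconst by (metis siterate.ctr id_apply)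
    then have "block ((parent ^^ (i + (i0 + c))) x) = []"
      by (simp only: block_ones)
    ultimately show ?thesis using length_alike by fastforce
  qed
  then show ?thesis using ones_if_blocks_empty assms(2) by blast
qed

theorem theorem5p4:
  fixes \<xi> \<eta> :: "bit stream"
  assumes "\<xi> \<in> E1" and "\<eta> \<in> E1"
  shows "((\<exists>u. \<xi> = u @- sconst 1) \<and> (\<exists>w. \<eta> = w @- sconst 1) \<longrightarrow> schreier \<xi> = schreier \<eta>) \<and>
    ((\<exists>u. \<xi> = u @- sconst 1) \<and> (\<forall>w. \<eta> \<noteq> w @- sconst 1) \<longrightarrow> \<not> schreier \<xi> \<simeq> schreier \<eta>) \<and>
    ((\<forall>u. \<xi> \<noteq> u @- sconst 1) \<and> (\<forall>w. \<eta> \<noteq> w @- sconst 1) \<longrightarrow>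
      (\<forall>k m t x k' m' t' y. canonical_rep \<xi> k m t x \<and> canonical_rep \<eta> k' m' t' y \<longrightarrow>
        (schreier \<eta> \<simeq> schreier \<xi> \<longleftrightarrow>
          (\<exists>r\<ge>1. \<exists>s\<ge>1. \<forall>n.
            m (r + n) = m' (s + n) \<and> t (r + n + 1) = t' (s + n + 1) \<and>
            k + (\<Sum>l=0..r. t l) + (\<Sum>l=0..r - 1. m l)
              = k' + (\<Sum>l=0..s. t' l) + (\<Sum>l=0..s - 1. m' l) \<and>
            ((\<forall>p\<in>{1..m (r + n) div 2}. y (s + n) p = x (r + n) p) \<or>
             (\<forall>p\<in>{1..m (r + n) div 2}. y (s + n) p = 1 - x (r + n) p))))))"
proof (intro conjI impI allI)
  assume "(\<exists>u. \<xi> = u @- sconst 1) \<and> (\<exists>w. \<eta> = w @- sconst 1)"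
  then show "schreier \<xi> = schreier \<eta>" using schreier_eq_ones assms by blast
next
  assume "(\<exists>u. \<xi> = u @- sconst 1) \<and> (\<forall>w. \<eta> \<noteq> w @- sconst 1)"
  then show "\<not> schreier \<xi> \<simeq> schreier \<eta>" using not_iso_ones assms by blast
next
  fix k m t x k' m' t' y
  assume "canonical_rep \<xi> k m t x \<and> canonical_rep \<eta> k' m' t' y"
  then interpret two_canonical \<xi> k m t x \<eta> k' m' t' y
    using assms by unfold_locales auto
  show "schreier \<eta> \<simeq> schreier \<xi> \<longleftrightarrow>
          (\<exists>r\<ge>1. \<exists>s\<ge>1. \<forall>n.
            m (r + n) = m' (s + n) \<and> t (r + n + 1) = t' (s + n + 1) \<and>
            k + (\<Sum>l=0..r. t l) + (\<Sum>l=0..r - 1. m l)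
              = k' + (\<Sum>l=0..s. t' l) + (\<Sum>l=0..s - 1. m' l) \<and>
            ((\<forall>p\<in>{1..m (r + n) div 2}. y (s + n) p = x (r + n) p) \<or>
             (\<forall>p\<in>{1..m (r + n) div 2}. y (s + n) p = 1 - x (r + n) p)))"
    using schreier_iso_iff schreier_iso_sym[OF assms] by simp
qed

end
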